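(* Let $A$ be a finite-dimensional basic algebra over an algebraically closed field $\Bbbk$ (given by a finite quiver with relations), with a filtration by two-sided ideals $A=I_0\supsetneq I_1\supsetneq\dots\supsetneq I_N=0$ such that $I_iI_j\subset I_{i+j}$ for all $i,j$ (with $I_m=0$ for $m\ge N$) and with semisimple subquotients $I_i/I_{i+1}$. Assume that $A$ is symmetric and that this filtration is both the radical and the socle filtration of the left regular module ${}_AA$ (i.e. ${}_AA$ is rigid). Then the algebra $\mathfrak{C}=\mathfrak{C}(A)$ is symmetric.
   Context: That the filtration is both the radical and the socle filtration means $I_j=\mathrm{Rad}^j({}_AA)$ and $I_j=\mathrm{soc}^{N-j}({}_AA)$ for $0\le j\le N$, where $\mathrm{soc}^m$ denotes the $m$-th term of the socle series. $A$ is symmetric if there is a non-degenerate symmetric bilinear form on $A$ with $(ab,c)=(a,bc)$. The (in general non-unital, infinite-dimensional) algebra $\mathfrak{C}(A)$ consists of $\mathbb{Z}\times\mathbb{Z}$-matrices with finitely many nonzero entries, $\mathfrak{C}(A)=\bigoplus_{r,c\in\mathbb{Z}}\mathfrak{C}_{r,c}$, where the entry in row $r$ and column $c$ lies in $$\mathfrak{C}_{r,c}=\begin{cases} I_{r-c}, & r>c,\\ A/I_{N-(c-r)}, & 0\le c-r<N,\\ 0, & c-r\ge N,\end{cases}$$ (where $I_m=0$ for $m\ge N$), with matrix multiplication induced by the multiplication of $A$ (this is well defined because $I_iI_j\subset I_{i+j}$). The algebra $\mathfrak{C}$ is called symmetric if there is a non-degenerate symmetric bilinear form $(\cdot,\cdot)_{\mathfrak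 C}$ on $\mathfrak{C}$ which is associative, i.e. $(ab,c)_{\mathfrak C}=(a,bc)_{\mathfrak C}$ for all $a,b,c\in\mathfrak{C}$. *)

theory Defs
  imports "HOL-Algebra.Algebraic_Closure" "HOL-Algebra.Ideal_Product"
begin

section \<open>Algebras over a field\<close>

text \<open>The locale \<open>algebra\<close> of HOL-Algebra demands commutativity; this is the noncommutative
  version.\<close>

locale assoc_algebra = module K A + ring A for K (structure) and A (structure) +
  assumes smult_mult_left:
      "\<lbrakk>c \<in> carrier K; x \<in> carrier A; y \<in> carrier A\<rbrakk>
        \<Longrightarrow> (c \<odot>\<^bsub>A\<^esub> x) \<otimes>\<^bsub>A\<^esub> y = c \<odot>\<^bsub>A\<^esub> (x \<otimes>\<^bsub>A\<^esub> y)"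
    and smult_mult_right:
      "\<lbrakk>c \<in> carrier K; x \<in> carrier A; y \<in> carrier A\<rbrakk>
        \<Longrightarrow> x \<otimes>\<^bsub>A\<^esub> (c \<odot>\<^bsub>A\<^esub> y) = c \<odot>\<^bsub>A\<^esub> (x \<otimes>\<^bsub>A\<^esub> y)"

definition finite_dimensional ::
  "('k, 'r) ring_scheme \<Rightarrow> ('k, 'a, 's) module_scheme \<Rightarrow> bool" where
  "finite_dimensional K V \<longleftrightarrow>
     (\<exists>B. finite B \<and> B \<subseteq> carrier V \<and>
        (\<forall>x\<in>carrier V. \<exists>c\<in>B \<rightarrow> carrier K. x = (\<Oplus>\<^bsub>V\<^esub>b\<in>B. c b \<odot>\<^bsub>V\<^esub> b)))"

definition bilinear_form ::
  "('k, 'r) ring_scheme \<Rightarrow> ('k, 'a, 's) module_scheme \<Rightarrow> ('a \<Rightarrow> 'a \<Rightarrow> 'k) \<Rightarrow> bool" where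
  "bilinear_form K V B \<longleftrightarrow>
     (\<forall>x\<in>carrier V. \<forall>y\<in>carrier V. B x y \<in> carrier K) \<and>
     (\<forall>x\<in>carrier V. \<forall>y\<in>carrier V. \<forall>z\<in>carrier V.
        B (x \<oplus>\<^bsub>V\<^esub> y) z = B x z \<oplus>\<^bsub>K\<^esub> B y z \<and> B x (y \<oplus>\<^bsub>V\<^esub> z) = B x y \<oplus>\<^bsub>K\<^esub> B x z) \<and>
     (\<forall>c\<in>carrier K. \<forall>x\<in>carrier V. \<forall>y\<in>carrier V.
        B (c \<odot>\<^bsub>V\<^esub> x) y = c \<otimes>\<^bsub>K\<^esub> B x y \<and> B x (c \<odot>\<^bsub>V\<^esub> y) = c \<otimes>\<^bsub>K\<^esub> B x y)"

text \<open>This does not mention the unit, so that it also makes sense for non-unital algebras; as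
  the form is symmetric, non-degeneracy in one argument suffices.\<close>

definition symmetric_algebra ::
  "('k, 'r) ring_scheme \<Rightarrow> ('k, 'a, 's) module_scheme \<Rightarrow> bool" where
  "symmetric_algebra K A \<longleftrightarrow>
     (\<exists>B. bilinear_form K A B \<and>
        (\<forall>a\<in>carrier A. \<forall>b\<in>carrier A. B a b = B b a) \<and>
        (\<forall>a\<in>carrier A. \<forall>b\<in>carrier A. \<forall>c\<in>carrier A. B (a \<otimes>\<^bsub>A\<^esub> b) c = B a (b \<otimes>\<^bsub>A\<^esub> c)) \<and>
        (\<forall>a\<in>carrier A. (\<forall>b\<in>carrier A. B a b = \<zero>\<^bsub>K\<^esub>) \<longrightarrow> a = \<zero>\<^bsub>A\<^esub>))"


section \<open>Left modules\<close>

text \<open>Left modules over a ring \<open>A\<close> are records of type \<^typ>\<open>('a, 'm) module\<close>. These records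
  carry fields \<open>mult\<close> and \<open>one\<close>, which are not used. The locale \<open>submodule\<close> does not require
  commutativity of the ring.\<close>

definition regular_module :: "('a, 'r) ring_scheme \<Rightarrow> ('a, 'a) module" where
  "regular_module A = \<lparr>carrier = carrier A, monoid.mult = monoid.mult A, one = \<one>\<^bsub>A\<^esub>,
     ring.zero = \<zero>\<^bsub>A\<^esub>, ring.add = ring.add A, smult = monoid.mult A\<rparr>"

definition coset_smult ::
  "('a, 'm, 's) module_scheme \<Rightarrow> 'm set \<Rightarrow> 'a \<Rightarrow> 'm set \<Rightarrow> 'm set" where
  "coset_smult M L a C = (\<Union>x\<in>C. L +>\<^bsub>M\<^esub> (a \<odot>\<^bsub>M\<^esub> x))"

definition quotient_module ::
  "('a, 'm, 's) module_scheme \<Rightarrow> 'm set \<Rightarrow> ('a, 'm set) module" where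
  "quotient_module M L = \<lparr>carrier = a_rcosets\<^bsub>M\<^esub> L, monoid.mult = undefined, one = undefined,
     ring.zero = L, ring.add = set_add M, smult = coset_smult M L\<rparr>"

definition module_isomorphic ::
  "('a, 'r) ring_scheme \<Rightarrow> ('a, 'm, 's) module_scheme \<Rightarrow> ('a, 'n, 't) module_scheme \<Rightarrow> bool" where
  "module_isomorphic A M N \<longleftrightarrow>
     (\<exists>h. bij_betw h (carrier M) (carrier N) \<and>
        (\<forall>x\<in>carrier M. \<forall>y\<in>carrier M. h (x \<oplus>\<^bsub>M\<^esub> y) = h x \<oplus>\<^bsub>N\<^esub> h y) \<and>
        (\<forall>a\<in>carrier A. \<forall>x\<in>carrier M. h (a \<odot>\<^bsub>M\<^esub> x) = a \<odot>\<^bsub>N\<^esub> h x))"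

definition simple_module ::
  "('a, 'r) ring_scheme \<Rightarrow> ('a, 'm, 's) module_scheme \<Rightarrow> bool" where
  "simple_module A M \<longleftrightarrow> carrier M \<noteq> {\<zero>\<^bsub>M\<^esub>} \<and>
     (\<forall>U. submodule U A M \<longrightarrow> U = {\<zero>\<^bsub>M\<^esub>} \<or> U = carrier M)"

definition maximal_submodule ::
  "'m set \<Rightarrow> ('a, 'r) ring_scheme \<Rightarrow> ('a, 'm, 's) module_scheme \<Rightarrow> bool" where
  "maximal_submodule U A M \<longleftrightarrow> submodule U A M \<and> U \<noteq> carrier M \<and>
     (\<forall>V. submodule V A M \<longrightarrow> U \<subseteq> V \<longrightarrow> V = U \<or> V = carrier M)"

definition module_radical ::
  "('a, 'r) ring_scheme \<Rightarrow> ('a, 'm, 's) module_scheme \<Rightarrow> 'm set" where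
  "module_radical A M = carrier M \<inter> \<Inter>{U. maximal_submodule U A M}"

text \<open>The sum of the simple submodules, as the smallest submodule containing them all.\<close>

definition socle ::
  "('a, 'r) ring_scheme \<Rightarrow> ('a, 'm, 's) module_scheme \<Rightarrow> 'm set" where
  "socle A M = \<Inter>{W. submodule W A M \<and>
     (\<forall>S. submodule S A M \<and> simple_module A (M\<lparr>carrier := S\<rparr>) \<longrightarrow> S \<subseteq> W)}"

definition semisimple_module ::
  "('a, 'r) ring_scheme \<Rightarrow> ('a, 'm, 's) module_scheme \<Rightarrow> bool" where
  "semisimple_module A M \<longleftrightarrow> socle A M = carrier M"

primrec radical_series ::
  "('a, 'r) ring_scheme \<Rightarrow> ('a, 'm, 's) module_scheme \<Rightarrow> nat \<Rightarrow> 'm set" where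
  "radical_series A M 0 = carrier M"
| "radical_series A M (Suc j) = module_radical A (M\<lparr>carrier := radical_series A M j\<rparr>)"

text \<open>The term of index \<open>Suc m\<close> is the preimage in \<open>M\<close> of the socle of \<open>M / soc\<^sup>m M\<close>.\<close>

primrec socle_series ::
  "('a, 'r) ring_scheme \<Rightarrow> ('a, 'm, 's) module_scheme \<Rightarrow> nat \<Rightarrow> 'm set" where
  "socle_series A M 0 = {\<zero>\<^bsub>M\<^esub>}"
| "socle_series A M (Suc m) =
     {x \<in> carrier M. socle_series A M m +>\<^bsub>M\<^esub> x \<in> socle A (quotient_module M (socle_series A M m))}"


section \<open>Basic algebras\<close>

definition idempotent_elem :: "('a, 'r) ring_scheme \<Rightarrow> 'a \<Rightarrow> bool" where
  "idempotent_elem A e \<longleftrightarrow> e \<in> carrier A \<and> e \<otimes>\<^bsub>A\<^esub> e = e"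

definition primitive_idempotent :: "('a, 'r) ring_scheme \<Rightarrow> 'a \<Rightarrow> bool" where
  "primitive_idempotent A e \<longleftrightarrow> idempotent_elem A e \<and> e \<noteq> \<zero>\<^bsub>A\<^esub> \<and>
     (\<forall>f g. idempotent_elem A f \<and> idempotent_elem A g \<and>
        f \<otimes>\<^bsub>A\<^esub> g = \<zero>\<^bsub>A\<^esub> \<and> g \<otimes>\<^bsub>A\<^esub> f = \<zero>\<^bsub>A\<^esub> \<and> e = f \<oplus>\<^bsub>A\<^esub> g \<longrightarrow> f = \<zero>\<^bsub>A\<^esub> \<or> g = \<zero>\<^bsub>A\<^esub>)"

definition principal_left_module :: "('a, 'r) ring_scheme \<Rightarrow> 'a \<Rightarrow> ('a, 'a) module" where
  "principal_left_module A e = (regular_module A)\<lparr>carrier := (\<lambda>x. x \<otimes>\<^bsub>A\<^esub> e) ` carrier A\<rparr>"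

definition basic_algebra :: "('a, 'r) ring_scheme \<Rightarrow> bool" where
  "basic_algebra A \<longleftrightarrow>
     (\<exists>E. finite E \<and> (\<forall>e\<in>E. primitive_idempotent A e) \<and>
        (\<forall>e\<in>E. \<forall>f\<in>E. e \<noteq> f \<longrightarrow> e \<otimes>\<^bsub>A\<^esub> f = \<zero>\<^bsub>A\<^esub>) \<and>
        (\<Oplus>\<^bsub>A\<^esub>e\<in>E. e) = \<one>\<^bsub>A\<^esub> \<and>
        (\<forall>e\<in>E. \<forall>f\<in>E. e \<noteq> f \<longrightarrow>
           \<not> module_isomorphic A (principal_left_module A e) (principal_left_module A f)))"


section \<open>Quivers with relations\<close>

record ('v, 'e) quiver =
  verts :: "'v set"
  arrows :: "'e set"
  source :: "'e \<Rightarrow> 'v"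
  target :: "'e \<Rightarrow> 'v"

definition finite_quiver :: "('v, 'e) quiver \<Rightarrow> bool" where
  "finite_quiver Q \<longleftrightarrow> finite (verts Q) \<and> finite (arrows Q) \<and>
     source Q ` arrows Q \<subseteq> verts Q \<and> target Q ` arrows Q \<subseteq> verts Q"

text \<open>A path is its start vertex together with the list of its arrows, in the order in which
  they are traversed; \<open>(v, [])\<close> is the trivial path at \<open>v\<close>.\<close>

fun is_path :: "('v, 'e) quiver \<Rightarrow> 'v \<times> 'e list \<Rightarrow> bool" where
  "is_path Q (v, []) \<longleftrightarrow> v \<in> verts Q"
| "is_path Q (v, a # as) \<longleftrightarrow> v \<in> verts Q \<and> a \<in> arrows Q \<and> source Q a = v \<and> is_path Q (target Q a, as)"

fun path_end :: "('v, 'e) quiver \<Rightarrow> 'v \<times> 'e list \<Rightarrow> 'v" where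
  "path_end Q (v, []) = v"
| "path_end Q (v, a # as) = path_end Q (target Q a, as)"

text \<open>Elements are the finitely supported coefficient functions on paths. The coefficient of a
  product at a path sums over all ways to cut that path into an initial and a final part.\<close>

definition path_algebra ::
  "('k, 'r) ring_scheme \<Rightarrow> ('v, 'e) quiver \<Rightarrow> ('k, 'v \<times> 'e list \<Rightarrow> 'k) module" where
  "path_algebra K Q = \<lparr>
     carrier = {f. finite {p. f p \<noteq> \<zero>\<^bsub>K\<^esub>} \<and> (\<forall>p. f p \<in> carrier K) \<and> (\<forall>p. \<not> is_path Q p \<longrightarrow> f p = \<zero>\<^bsub>K\<^esub>)},
     monoid.mult = (\<lambda>f g (v, as). \<Oplus>\<^bsub>K\<^esub>i\<in>{..length as}.
        f (v, take i as) \<otimes>\<^bsub>K\<^esub> g (path_end Q (v, take i as), drop i as)),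
     one = (\<lambda>(v, as). if v \<in> verts Q \<and> as = [] then \<one>\<^bsub>K\<^esub> else \<zero>\<^bsub>K\<^esub>),
     ring.zero = (\<lambda>p. \<zero>\<^bsub>K\<^esub>),
     ring.add = (\<lambda>f g p. f p \<oplus>\<^bsub>K\<^esub> g p),
     smult = (\<lambda>c f p. c \<otimes>\<^bsub>K\<^esub> f p)\<rparr>"

text \<open>The \<open>m\<close>-th power of the arrow ideal is spanned by the paths of length at least \<open>m\<close>.\<close>

definition arrow_ideal_power ::
  "('k, 'r) ring_scheme \<Rightarrow> ('v, 'e) quiver \<Rightarrow> nat \<Rightarrow> ('v \<times> 'e list \<Rightarrow> 'k) set" where
  "arrow_ideal_power K Q m =
     {f \<in> carrier (path_algebra K Q). \<forall>v as. f (v, as) \<noteq> \<zero>\<^bsub>K\<^esub> \<longrightarrow> m \<le> length as}"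

definition admissible_ideal ::
  "('k, 'r) ring_scheme \<Rightarrow> ('v, 'e) quiver \<Rightarrow> ('v \<times> 'e list \<Rightarrow> 'k) set \<Rightarrow> bool" where
  "admissible_ideal K Q J \<longleftrightarrow> ideal J (path_algebra K Q) \<and>
     (\<exists>m\<ge>2. arrow_ideal_power K Q m \<subseteq> J) \<and> J \<subseteq> arrow_ideal_power K Q 2"

text \<open>Since vertices and arrows are finite in number, they may be taken to be natural numbers.\<close>

definition given_by_quiver_with_relations ::
  "('k, 'r) ring_scheme \<Rightarrow> ('k, 'a, 's) module_scheme \<Rightarrow> bool" where
  "given_by_quiver_with_relations K A \<longleftrightarrow>
     (\<exists>(Q :: (nat, nat) quiver) J h. finite_quiver Q \<and> admissible_ideal K Q J \<and>
        h \<in> ring_iso (path_algebra K Q Quot J) A \<and>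
        (\<forall>c\<in>carrier K. \<forall>C\<in>carrier (path_algebra K Q Quot J).
           h (coset_smult (path_algebra K Q) J c C) = c \<odot>\<^bsub>A\<^esub> h C))"


section \<open>Filtrations and the matrix algebra\<close>

definition ideal_filtration ::
  "('a, 'r) ring_scheme \<Rightarrow> nat \<Rightarrow> (nat \<Rightarrow> 'a set) \<Rightarrow> bool" where
  "ideal_filtration A N I \<longleftrightarrow>
     (\<forall>i. ideal (I i) A) \<and> I 0 = carrier A \<and> (\<forall>i<N. I (Suc i) \<subset> I i) \<and>
     (\<forall>m\<ge>N. I m = {\<zero>\<^bsub>A\<^esub>}) \<and> (\<forall>i j. I i \<cdot>\<^bsub>A\<^esub> I j \<subseteq> I (i + j))"

definition semisimple_subquotients ::
  "('a, 'r) ring_scheme \<Rightarrow> nat \<Rightarrow> (nat \<Rightarrow> 'a set) \<Rightarrow> bool" where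
  "semisimple_subquotients A N I \<longleftrightarrow>
     (\<forall>i<N. semisimple_module A
        (quotient_module ((regular_module A)\<lparr>carrier := I i\<rparr>) (I (Suc i))))"

text \<open>All entries are cosets modulo an ideal that depends on the position: below the diagonal
  modulo \<open>0\<close>, so that \<open>x \<in> I\<^bsub>r-c\<^esub>\<close> appears as \<open>{x}\<close>, and far above the diagonal modulo \<open>A\<close>,
  where \<open>A / A\<close> is the zero space.\<close>

definition entry_modulus ::
  "('a, 'r) ring_scheme \<Rightarrow> nat \<Rightarrow> (nat \<Rightarrow> 'a set) \<Rightarrow> int \<Rightarrow> int \<Rightarrow> 'a set" where
  "entry_modulus A N I r c =
     (if r > c then {\<zero>\<^bsub>A\<^esub>} else if c - r < int N then I (N - nat (c - r)) else carrier A)"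

definition entry_space ::
  "('a, 'r) ring_scheme \<Rightarrow> nat \<Rightarrow> (nat \<Rightarrow> 'a set) \<Rightarrow> int \<Rightarrow> int \<Rightarrow> 'a set set" where
  "entry_space A N I r c =
     (\<lambda>x. entry_modulus A N I r c +>\<^bsub>A\<^esub> x) ` (if r > c then I (nat (r - c)) else carrier A)"

text \<open>The zero of the entry space at \<open>(r, c)\<close> is the coset \<open>entry_modulus A N I r c\<close> itself.
  The sum in \<open>mult\<close> runs over the finitely many nonzero entries in row \<open>r\<close> of the left factor.
  The algebra has no unit in general and its field \<open>one\<close> is not used.\<close>

definition matrix_algebra_C ::
  "('k, 'a, 's) module_scheme \<Rightarrow> nat \<Rightarrow> (nat \<Rightarrow> 'a set) \<Rightarrow> ('k, int \<Rightarrow> int \<Rightarrow> 'a set) module" where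
  "matrix_algebra_C A N I = (let L = entry_modulus A N I in \<lparr>
     carrier = {F. (\<forall>r c. F r c \<in> entry_space A N I r c) \<and> finite {(r, c). F r c \<noteq> L r c}},
     monoid.mult = (\<lambda>F G r t. \<Oplus>\<^bsub>A Quot L r t\<^esub>s\<in>{s. F r s \<noteq> L r s}. rcoset_mult A (L r t) (F r s) (G s t)),
     one = undefined,
     ring.zero = L,
     ring.add = (\<lambda>F G r c. F r c <+>\<^bsub>A\<^esub> G r c),
     smult = (\<lambda>k F r c. coset_smult A (L r c) k (F r c))\<rparr>)"

end

theory Submission
  imports Defs
begin

text \<open>
  Put \<open>J\<^bsub>d\<^esub> = I\<^bsub>d\<^esub>\<close> for \<open>d > 0\<close> and \<open>J\<^bsub>d\<^esub> = A\<close> for \<open>d \<le> 0\<close>. Then all three kinds of entries are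
  instances of one formula: the entry space at \<open>(r, c)\<close> is \<open>J\<^bsub>r-c\<^esub> / J\<^bsub>N+r-c\<^esub>\<close>. If \<open>(\<cdot>, \<cdot>)\<close> is a
  symmetrizing form of \<open>A\<close>, the natural candidate for the matrices is the trace form
  \<open>(F, G) = \<Sum>\<^bsub>r,c\<^esub> (F\<^bsub>rc\<^esub>, G\<^bsub>cr\<^esub>)\<close>, in which \<open>J\<^bsub>d\<^esub> / J\<^bsub>N+d\<^esub>\<close> is paired with \<open>J\<^bsub>-d\<^esub> / J\<^bsub>N-d\<^esub>\<close>. It is symmetric
  and associative because the form of \<open>A\<close> is. It is well defined and non-degenerate as soon as the
  filtration is self-dual, that is, \<open>J\<^bsub>N-d\<^esub>\<close> is the orthogonal complement of \<open>J\<^bsub>d\<^esub>\<close> for every \<open>d\<close>.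

  One half of the self-duality is immediate: \<open>J\<^bsub>d\<^esub> J\<^bsub>N-d\<^esub> \<subseteq> J\<^bsub>N\<^esub> = 0\<close>, and \<open>(x, y) = (xy, 1)\<close>. For the other
  half (\<open>orthogonal_imp_annihilates\<close>), an element \<open>x\<close> orthogonal to the ideal \<open>I\<^bsub>d\<^esub>\<close> satisfies
  \<open>(yx, b) = (x, by) = 0\<close> for all \<open>y \<in> I\<^bsub>d\<^esub>\<close> and all \<open>b\<close>, so \<open>I\<^bsub>d\<^esub> x = 0\<close> by non-degeneracy. What
  remains is that the left annihilator condition \<open>I\<^bsub>d\<^esub> x = 0\<close> forces \<open>x \<in> soc\<^sup>d A = I\<^bsub>N-d\<^esub>\<close>
  (\<open>annihilator_subset_socle_term\<close>). By induction on \<open>d\<close> this reduces to one step: if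
  \<open>I\<^bsub>1\<^esub> x \<subseteq> L\<close>, then \<open>x + L\<close> lies in the socle of \<open>A / L\<close>. Indeed \<open>x + L\<close> is the image of \<open>1 + I\<^bsub>1\<^esub>\<close> under
  the homomorphism \<open>A / I\<^bsub>1\<^esub> \<rightarrow> A / L\<close>, \<open>a + I\<^bsub>1\<^esub> \<mapsto> ax + L\<close>; the module \<open>A / I\<^bsub>1\<^esub>\<close> is
  semisimple, so it is its own socle, and homomorphisms map socles into socles (\<open>socle_image\<close>).
\<close>

section \<open>Socles and module homomorphisms\<close>

lemma submodule_of_submodule_iff:
  assumes M: "group (add_monoid M)" and S: "submodule S A M"
  shows "submodule U A (M\<lparr>carrier := S\<rparr>) \<longleftrightarrow> submodule U A M \<and> U \<subseteq> S"
proof -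
  interpret group "add_monoid M" by (rule M)
  have S': "subgroup S (add_monoid M)" using S by (simp add: submodule_def)
  have "subgroup U ((add_monoid M)\<lparr>carrier := S\<rparr>) \<longleftrightarrow> subgroup U (add_monoid M) \<and> U \<subseteq> S"
    using incl_subgroup[OF S'] subgroup_incl[OF _ S'] subgroup.subset by fastforce
  then show ?thesis
    by (auto simp: submodule_def submodule_axioms_def)
qed

lemma submodule_vimage:
  assumes h: "group_hom (add_monoid M) (add_monoid M') h"
    and smult: "\<And>a x. \<lbrakk>a \<in> carrier A; x \<in> carrier M\<rbrakk> \<Longrightarrow>
      a \<odot>\<^bsub>M\<^esub> x \<in> carrier M \<and> h (a \<odot>\<^bsub>M\<^esub> x) = a \<odot>\<^bsub>M'\<^esub> h x"
    and W: "submodule W A M'"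
  shows "submodule {x \<in> carrier M. h x \<in> W} A M"
proof -
  interpret group_hom "add_monoid M" "add_monoid M'" h by (rule h)
  interpret W: submodule W A M' by (rule W)
  show ?thesis
  proof (intro submodule.intro submodule_axioms.intro)
    show "subgroup {x \<in> carrier M. h x \<in> W} (add_monoid M)"
    proof (rule G.subgroupI)
      show "{x \<in> carrier M. h x \<in> W} \<noteq> {}"
      proof -
        have "\<zero>\<^bsub>M\<^esub> \<in> {x \<in> carrier M. h x \<in> W}"
          using G.one_closed hom_one W.one_closed by simp
        then show ?thesis by blast
      qed
    next
      fix a assume "a \<in> {x \<in> carrier M. h x \<in> W}"
      then show "inv\<^bsub>add_monoid M\<^esub> a \<in> {x \<in> carrier M. h x \<in> W}"
        using G.inv_closed[of a] hom_inv[of a] W.m_inv_closed[of "h a"] by simp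
    next
      fix a b assume "a \<in> {x \<in> carrier M. h x \<in> W}" "b \<in> {x \<in> carrier M. h x \<in> W}"
      then show "a \<otimes>\<^bsub>add_monoid M\<^esub> b \<in> {x \<in> carrier M. h x \<in> W}"
        using G.m_closed[of a b] hom_mult[of a b] W.m_closed[of "h a" "h b"] by simp
    qed auto
  qed (use smult in auto)
qed

lemma submodule_image:
  assumes h: "group_hom (add_monoid M) (add_monoid M') h"
    and smult: "\<And>a x. \<lbrakk>a \<in> carrier A; x \<in> carrier M\<rbrakk> \<Longrightarrow>
      a \<odot>\<^bsub>M\<^esub> x \<in> carrier M \<and> h (a \<odot>\<^bsub>M\<^esub> x) = a \<odot>\<^bsub>M'\<^esub> h x"
    and S: "submodule S A M"
  shows "submodule (h ` S) A M'"
proof -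
  interpret group_hom "add_monoid M" "add_monoid M'" h by (rule h)
  interpret S: submodule S A M by (rule S)
  show ?thesis
  proof (intro submodule.intro submodule_axioms.intro)
    show "subgroup (h ` S) (add_monoid M')"
      by (rule subgroup_img_is_subgroup[OF S.subgroup_axioms])
  next
    fix a y assume a: "a \<in> carrier A" and "y \<in> h ` S"
    then obtain x where x: "x \<in> S" "y = h x" by auto
    then have "a \<odot>\<^bsub>M'\<^esub> y = h (a \<odot>\<^bsub>M\<^esub> x)"
      using smult[OF a, of x] S.subset by auto
    then show "a \<odot>\<^bsub>M'\<^esub> y \<in> h ` S" using a x by blast
  qed
qed

text \<open>The image of a simple submodule is zero or simple, so the preimage of a submodule that contains
  all simple submodules of the target contains all simple submodules of the source.\<close>

lemma socle_image:
  assumes h: "group_hom (add_monoid M) (add_monoid M') h"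
    and smult: "\<And>a x. \<lbrakk>a \<in> carrier A; x \<in> carrier M\<rbrakk> \<Longrightarrow>
      a \<odot>\<^bsub>M\<^esub> x \<in> carrier M \<and> h (a \<odot>\<^bsub>M\<^esub> x) = a \<odot>\<^bsub>M'\<^esub> h x"
    and x: "x \<in> socle A M"
  shows "h x \<in> socle A M'"
  unfolding socle_def
proof (intro InterI, clarify)
  interpret group_hom "add_monoid M" "add_monoid M'" h by (rule h)
  fix W assume W: "submodule W A M'"
    and simp_W: "\<forall>S. submodule S A M' \<and> simple_module A (M'\<lparr>carrier := S\<rparr>) \<longrightarrow> S \<subseteq> W"
  interpret W: submodule W A M' by (rule W)
  have "S \<subseteq> {x \<in> carrier M. h x \<in> W}"
    if S: "submodule S A M" and simple: "simple_module A (M\<lparr>carrier := S\<rparr>)" for S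
  proof -
    interpret S: submodule S A M by (rule S)
    have hS: "submodule (h ` S) A M'" by (rule submodule_image[OF h smult S])
    have "h ` S \<subseteq> W"
    proof (cases "h ` S = {\<zero>\<^bsub>M'\<^esub>}")
      case True
      then show ?thesis using W.one_closed by simp
    next
      case False
      have "U = {\<zero>\<^bsub>M'\<^esub>} \<or> U = h ` S" if U: "submodule U A M'" "U \<subseteq> h ` S" for U
      proof -
        interpret U: submodule U A M' by (rule U)
        \<comment> \<open>Since \<open>S\<close> is simple, the preimage of \<open>U\<close> in \<open>S\<close> is zero or everything.\<close>
        let ?T = "S \<inter> {x \<in> carrier M. h x \<in> U}"
        have "submodule ?T A M"
          using S submodule_vimage[OF h smult U(1)]
            G.subgroups_Inter_pair[of S "{x \<in> carrier M. h x \<in> U}"]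
          by (auto simp: submodule_def submodule_axioms_def)
        then have "?T = {\<zero>\<^bsub>M\<^esub>} \<or> ?T = S"
          using simple submodule_of_submodule_iff[OF G.is_group S]
          by (simp add: simple_module_def)
        then show ?thesis
        proof
          assume T: "?T = {\<zero>\<^bsub>M\<^esub>}"
          have "u = \<zero>\<^bsub>M'\<^esub>" if "u \<in> U" for u
          proof -
            obtain s where s: "s \<in> S" "u = h s" using \<open>u \<in> U\<close> U(2) by blast
            then have "s \<in> ?T" using \<open>u \<in> U\<close> S.mem_carrier[of s] by simp
            then have "s = \<zero>\<^bsub>M\<^esub>" unfolding T by blast
            then show ?thesis using s hom_one by simp
          qed
          moreover have "\<zero>\<^bsub>M'\<^esub> \<in> U" using U.one_closed by simp
          ultimately show ?thesis by blast
        next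
          assume "?T = S"
          then have "h ` S \<subseteq> U" by blast
          then show ?thesis using U(2) by blast
        qed
      qed
      then have "simple_module A (M'\<lparr>carrier := h ` S\<rparr>)"
        using False by (simp add: simple_module_def submodule_of_submodule_iff[OF H.is_group hS])
      then show ?thesis using hS simp_W by blast
    qed
    then show ?thesis using S.mem_carrier by auto
  qed
  then have "x \<in> {x \<in> carrier M. h x \<in> W}"
    using x submodule_vimage[OF h smult W] unfolding socle_def by blast
  then show "h x \<in> W" by simp
qed

section \<open>Quotients of the regular module\<close>

lemma regular_module_simps [simp]:
  "carrier (regular_module A) = carrier A" "\<zero>\<^bsub>regular_module A\<^esub> = \<zero>\<^bsub>A\<^esub>"
  "x \<oplus>\<^bsub>regular_module A\<^esub> y = x \<oplus>\<^bsub>A\<^esub> y" "a \<odot>\<^bsub>regular_module A\<^esub> y = a \<otimes>\<^bsub>A\<^esub> y"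
  "L +>\<^bsub>regular_module A\<^esub> x = L +>\<^bsub>A\<^esub> x"
  by (simp_all add: regular_module_def a_r_coset_def r_coset_def)

lemma regular_module_add: "set_add (regular_module A) = set_add A"
  by (simp add: fun_eq_iff set_add_def set_mult_def regular_module_def)

lemma (in ring) group_quotient_regular:
  assumes "ideal L R"
  shows "group (add_monoid (quotient_module (regular_module R) L))"
proof -
  interpret ideal L R by fact
  have "group (add_monoid (R Quot L))"
    using quotient_is_ring by (auto simp: ring_def dest!: abelian_group.a_group)
  moreover have "a_rcosets\<^bsub>regular_module R\<^esub> L = a_rcosets L"
    by (simp add: A_RCOSETS_def')
  ultimately show ?thesis
    by (simp add: group_def group_axioms_def monoid_def Units_def
        FactRing_def quotient_module_def regular_module_add)
qed

text \<open>The operations on cosets are unions over all representatives; this evaluates such a union at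
  a chosen representative.\<close>

lemma (in ideal) UN_coset_eqI:
  assumes "x \<in> carrier R" "x \<in> C" "\<And>y. y \<in> C \<Longrightarrow> f y \<in> I +> f x" "f x \<in> carrier R"
  shows "(\<Union>y\<in>C. I +> f y) = I +> f x"
proof -
  have "I +> f y = I +> f x" if "y \<in> C" for y
    using assms(3)[OF that] assms(4) a_repr_independence[OF _ _ a_subgroup] by auto
  then show ?thesis using assms(2) by blast
qed

lemma (in ring) quotient_regular_smult:
  assumes "ideal L R" and a: "a \<in> carrier R" and b: "b \<in> carrier R"
  shows "b \<odot>\<^bsub>quotient_module (regular_module R) L\<^esub> (L +> a) = L +> (b \<otimes> a)"
proof -
  interpret ideal L R by fact
  have "(\<Union>y\<in>L +> a. L +> (b \<otimes> y)) = L +> (b \<otimes> a)"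
  proof (rule UN_coset_eqI)
    fix y assume "y \<in> L +> a"
    then obtain i where i: "i \<in> L" "y = i \<oplus> a" by (auto simp: a_r_coset_def')
    then have "b \<otimes> y = b \<otimes> i \<oplus> b \<otimes> a" using a b Icarr r_distr by blast
    then show "b \<otimes> y \<in> L +> (b \<otimes> a)"
      using I_l_closed[OF i(1) b] by (auto simp: a_r_coset_def')
  qed (use a b in \<open>auto intro: a_rcos_self\<close>)
  then show ?thesis by (simp add: quotient_module_def coset_smult_def)
qed

text \<open>Right multiplication by \<open>x\<close> induces a homomorphism from \<open>R / I\<close> to \<open>R / L\<close> that sends the
  coset of \<open>\<one>\<close> to the coset of \<open>x\<close>, and \<open>R / I\<close> is its own socle.\<close>

lemma (in ring) annihilated_coset_in_socle:
  assumes I: "ideal I R" and L: "ideal L R"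
    and ss: "semisimple_module R (quotient_module (regular_module R) I)"
    and x: "x \<in> carrier R" and ann: "\<And>a. a \<in> I \<Longrightarrow> a \<otimes> x \<in> L"
  shows "L +> x \<in> socle R (quotient_module (regular_module R) L)"
proof -
  interpret I: ideal I R by (rule I)
  interpret L: ideal L R by (rule L)
  let ?M = "quotient_module (regular_module R) I" and ?M' = "quotient_module (regular_module R) L"
  define h where "h = (\<lambda>C. \<Union>a\<in>C. L +> (a \<otimes> x))"
  have h: "h (I +> a) = L +> (a \<otimes> x)" if a: "a \<in> carrier R" for a
    unfolding h_def
  proof (rule L.UN_coset_eqI)
    fix y assume "y \<in> I +> a"
    then obtain i where i: "i \<in> I" "y = i \<oplus> a" by (auto simp: a_r_coset_def')
    then have "y \<otimes> x = i \<otimes> x \<oplus> a \<otimes> x" using a x I.Icarr l_distr by blast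
    then show "y \<otimes> x \<in> L +> (a \<otimes> x)" using ann[OF i(1)] by (auto simp: a_r_coset_def')
  qed (use a x in \<open>auto intro: I.a_rcos_self\<close>)
  have smultI: "b \<odot>\<^bsub>?M\<^esub> (I +> a) = I +> (b \<otimes> a)"
    if "b \<in> carrier R" "a \<in> carrier R" for a b
    using quotient_regular_smult[OF I] that by blast
  have smultL: "b \<odot>\<^bsub>?M'\<^esub> (L +> a) = L +> (b \<otimes> a)"
    if "b \<in> carrier R" "a \<in> carrier R" for a b
    using quotient_regular_smult[OF L] that by blast
  have M: "carrier ?M = (\<lambda>a. I +> a) ` carrier R" and M': "carrier ?M' = (\<lambda>a. L +> a) ` carrier R"
    by (auto simp: quotient_module_def A_RCOSETS_def' regular_module_def a_r_coset_def r_coset_def)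
have "h \<in> hom (add_monoid ?M) (add_monoid ?M')"
  proof (rule homI)
    fix C D assume "C \<in> carrier (add_monoid ?M)" "D \<in> carrier (add_monoid ?M)"
    then obtain a b where "a \<in> carrier R" "C = I +> a" "b \<in> carrier R" "D = I +> b"
      using M by auto
    then show "h (C \<otimes>\<^bsub>add_monoid ?M\<^esub> D) = h C \<otimes>\<^bsub>add_monoid ?M'\<^esub> h D"
      using x by (simp add: quotient_module_def regular_module_add I.a_rcos_sum L.a_rcos_sum h l_distr)
  qed (use x M M' h in auto)
  then have "group_hom (add_monoid ?M) (add_monoid ?M') h"
    using group_quotient_regular[OF I] group_quotient_regular[OF L]
    by (simp add: group_hom_def group_hom_axioms_def)
  moreover have "b \<odot>\<^bsub>?M\<^esub> C \<in> carrier ?M \<and> h (b \<odot>\<^bsub>?M\<^esub> C) = b \<odot>\<^bsub>?M'\<^esub> h C"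
    if b: "b \<in> carrier R" and C: "C \<in> carrier ?M" for b C
    using b x C by (auto simp: M smultI smultL h m_assoc)
  moreover have "I +> \<one> \<in> socle R ?M"
    using ss by (simp add: semisimple_module_def M)
  ultimately have "h (I +> \<one>) \<in> socle R ?M'"
    by (rule socle_image)
  then show ?thesis using x by (simp add: h)
qed

section \<open>Self-duality of a rigid filtration\<close>

lemma ideal_filtration_mult:
  "\<lbrakk>ideal_filtration A N I; x \<in> I i; y \<in> I j\<rbrakk> \<Longrightarrow> x \<otimes>\<^bsub>A\<^esub> y \<in> I (i + j)"
  unfolding ideal_filtration_def by (blast intro: ideal_prod.prod)

text \<open>Since \<open>I\<^bsub>d\<^esub> I\<^bsub>1\<^esub> \<subseteq> I\<^bsub>d+1\<^esub>\<close>, every element of \<open>I\<^bsub>1\<^esub> x\<close> is annihilated by \<open>I\<^bsub>d\<^esub>\<close> if \<open>x\<close> is annihilated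
  by \<open>I\<^bsub>d+1\<^esub>\<close>. The induction hypothesis puts \<open>I\<^bsub>1\<^esub> x\<close> into the \<open>d\<close>-th socle term, so that \<open>x\<close> lies
  in the next one.\<close>

lemma (in ring) annihilator_subset_socle_term:
  assumes filt: "ideal_filtration R N I"
    and ss: "semisimple_module R (quotient_module (regular_module R) (I 1))"
    and soc: "\<And>j. j \<le> N \<Longrightarrow> I j = socle_series R (regular_module R) (N - j)"
    and "d \<le> N" and x: "x \<in> carrier R" and ann: "\<And>a. a \<in> I d \<Longrightarrow> a \<otimes> x = \<zero>"
  shows "x \<in> I (N - d)"
  using \<open>d \<le> N\<close> x ann
proof (induction d arbitrary: x)
  case 0
  then have "\<one> \<otimes> x = \<zero>" using filt by (auto simp: ideal_filtration_def)
  then show ?case using 0 filt by (simp add: ideal_filtration_def)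
next
  case (Suc d)
  have ideal: "ideal (I i) R" for i using filt by (simp add: ideal_filtration_def)
  note carr = ideal.Icarr[OF ideal]
  have "a \<otimes> x \<in> I (N - d)" if a: "a \<in> I 1" for a
  proof (rule Suc.IH)
    fix b assume b: "b \<in> I d"
    have "b \<otimes> a \<in> I (d + 1)"
      by (rule ideal_filtration_mult[OF filt b a])
    then show "b \<otimes> (a \<otimes> x) = \<zero>"
      using Suc.prems(2,3) carr[OF a] carr[OF b] by (simp flip: m_assoc)
  qed (use Suc.prems carr[OF a] in auto)
  then have "I (N - d) +> x \<in> socle R (quotient_module (regular_module R) (I (N - d)))"
    using annihilated_coset_in_socle[OF ideal ideal ss Suc.prems(2)] by blast
  moreover have "I (N - d) = socle_series R (regular_module R) d"
    using soc[of "N - d"] Suc.prems(1) by simp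
  ultimately have "x \<in> socle_series R (regular_module R) (Suc d)"
    using Suc.prems(2) by simp
  then show ?case using soc[of "N - Suc d"] Suc.prems(1) by simp
qed

text \<open>Because \<open>B (y \<otimes> x) b = B (x \<otimes> b) y = B x (b \<otimes> y)\<close> and \<open>b \<otimes> y \<in> I\<close>. The element \<open>z\<close> stands for
  the zero of the field in which the form takes its values.\<close>

lemma (in ring) orthogonal_imp_annihilates:
  assumes I: "ideal I R"
    and assoc: "\<And>a b c. \<lbrakk>a \<in> carrier R; b \<in> carrier R; c \<in> carrier R\<rbrakk> \<Longrightarrow> B (a \<otimes> b) c = B a (b \<otimes> c)"
    and sym: "\<And>a b. \<lbrakk>a \<in> carrier R; b \<in> carrier R\<rbrakk> \<Longrightarrow> B a b = B b a"
    and nondeg: "\<And>a. \<lbrakk>a \<in> carrier R; \<And>b. b \<in> carrier R \<Longrightarrow> B a b = z\<rbrakk> \<Longrightarrow> a = \<zero>"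
    and x: "x \<in> carrier R" and orth: "\<And>y. y \<in> I \<Longrightarrow> B x y = z" and y: "y \<in> I"
  shows "y \<otimes> x = \<zero>"
proof (rule nondeg)
  have yc: "y \<in> carrier R" using ideal.Icarr[OF I y] .
  then show "y \<otimes> x \<in> carrier R" using x by simp
  fix b assume b: "b \<in> carrier R"
  have "B (y \<otimes> x) b = B y (x \<otimes> b)" using assoc yc x b by simp
  also have "\<dots> = B (x \<otimes> b) y" using sym yc x b by simp
  also have "\<dots> = B x (b \<otimes> y)" using assoc yc x b by simp
  also have "\<dots> = z" using orth ideal.I_l_closed[OF I y b] by simp
  finally show "B (y \<otimes> x) b = z" .
qed

section \<open>Finite sums\<close>

lemma (in abelian_monoid) finsum_swap:
  assumes "finite S" "finite T" and "\<And>s t. \<lbrakk>s \<in> S; t \<in> T\<rbrakk> \<Longrightarrow> f s t \<in> carrier G"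
  shows "(\<Oplus>s\<in>S. \<Oplus>t\<in>T. f s t) = (\<Oplus>t\<in>T. \<Oplus>s\<in>S. f s t)"
  using \<open>finite S\<close> assms(3)
proof (induction S rule: finite_induct)
  case empty
  then show ?case by simp
next
  case (insert u S)
  have 1: "(\<lambda>s. \<Oplus>t\<in>T. f s t) \<in> S \<rightarrow> carrier G" "(\<Oplus>t\<in>T. f u t) \<in> carrier G"
    using insert.prems by (auto intro!: finsum_closed)
  have 2: "(\<lambda>t. f u t) \<in> T \<rightarrow> carrier G" "(\<lambda>t. \<Oplus>s\<in>S. f s t) \<in> T \<rightarrow> carrier G"
    using insert.prems by (auto intro!: finsum_closed)
  have "(\<Oplus>s\<in>insert u S. \<Oplus>t\<in>T. f s t) = (\<Oplus>t\<in>T. f u t) \<oplus> (\<Oplus>t\<in>T. \<Oplus>s\<in>S. f s t)"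
    using insert 1 by simp
  also have "\<dots> = (\<Oplus>t\<in>T. f u t \<oplus> (\<Oplus>s\<in>S. f s t))"
    using finsum_addf[OF 2] by simp
  also have "\<dots> = (\<Oplus>t\<in>T. \<Oplus>s\<in>insert u S. f s t)"
    using insert.hyps insert.prems
    by (intro finsum_cong') (auto intro!: finsum_closed simp: Pi_def)
  finally show ?case .
qed

lemma (in ideal) finsum_quotient:
  assumes "finite S" "f \<in> S \<rightarrow> carrier R"
  shows "(\<Oplus>\<^bsub>R Quot I\<^esub>s\<in>S. I +> f s) = I +> (\<Oplus>s\<in>S. f s)"
  using assms
proof (induction S rule: finite_induct)
  interpret Q: ring "R Quot I" by (rule quotient_is_ring)
  case empty
  have "I = \<zero>\<^bsub>R Quot I\<^esub>" by (simp add: FactRing_def)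
  then show ?case using a_rcos_const[OF additive_subgroup.zero_closed[OF is_additive_subgroup]]
    by simp
next
  interpret Q: ring "R Quot I" by (rule quotient_is_ring)
  case (insert u S)
  have set_add_eq: "set_add R U V = U \<oplus>\<^bsub>R Quot I\<^esub> V" for U V by (simp add: FactRing_def)
  from insert have "(\<lambda>s. I +> f s) \<in> S \<rightarrow> carrier (R Quot I)" "I +> f u \<in> carrier (R Quot I)"
    by (auto simp: FactRing_def intro!: a_rcosetsI[OF a_subset])
  then have "(\<Oplus>\<^bsub>R Quot I\<^esub>s\<in>insert u S. I +> f s) = (I +> f u) <+> (I +> (\<Oplus>s\<in>S. f s))"
    using insert Q.finsum_insert[of S u "\<lambda>s. I +> f s"]
    by (simp add: set_add_eq)
  also have "\<dots> = I +> (f u \<oplus> (\<Oplus>s\<in>S. f s))"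
    using insert.prems by (intro a_rcos_sum) auto
  finally show ?case using insert by simp
qed

section \<open>The filtration indexed by the integers\<close>

text \<open>The only duality assumed is that the orthogonal complement of \<open>I\<^bsub>d\<^esub>\<close> is contained in \<open>I\<^bsub>N-d\<^esub>\<close>; the
  reverse inclusion follows from multiplicativity (\<open>orthogonal\<close> below).\<close>

locale self_dual_filtration = K: cring K + A: ring A
  for K :: "('k, 'r) ring_scheme" (structure) and A :: "('k, 'a, 's) module_scheme" (structure) +
  fixes N :: nat and I :: "nat \<Rightarrow> 'a set" and B :: "'a \<Rightarrow> 'a \<Rightarrow> 'k"
  assumes smult_closed: "\<lbrakk>k \<in> carrier K; x \<in> carrier A\<rbrakk> \<Longrightarrow> k \<odot>\<^bsub>A\<^esub> x \<in> carrier A"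
    and smult_r_distr: "\<lbrakk>k \<in> carrier K; x \<in> carrier A; y \<in> carrier A\<rbrakk>
      \<Longrightarrow> k \<odot>\<^bsub>A\<^esub> (x \<oplus>\<^bsub>A\<^esub> y) = k \<odot>\<^bsub>A\<^esub> x \<oplus>\<^bsub>A\<^esub> k \<odot>\<^bsub>A\<^esub> y"
    and smult_mult_left: "\<lbrakk>k \<in> carrier K; x \<in> carrier A; y \<in> carrier A\<rbrakk>
      \<Longrightarrow> (k \<odot>\<^bsub>A\<^esub> x) \<otimes>\<^bsub>A\<^esub> y = k \<odot>\<^bsub>A\<^esub> (x \<otimes>\<^bsub>A\<^esub> y)"
    and filtration: "ideal_filtration A N I"
    and form: "bilinear_form K A B"
    and form_sym: "\<lbrakk>x \<in> carrier A; y \<in> carrier A\<rbrakk> \<Longrightarrow> B x y = B y x"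
    and form_assoc: "\<lbrakk>x \<in> carrier A; y \<in> carrier A; z \<in> carrier A\<rbrakk>
      \<Longrightarrow> B (x \<otimes>\<^bsub>A\<^esub> y) z = B x (y \<otimes>\<^bsub>A\<^esub> z)"
    and orthogonal_subset: "\<lbrakk>d \<le> N; x \<in> carrier A; \<And>y. y \<in> I d \<Longrightarrow> B x y = \<zero>\<^bsub>K\<^esub>\<rbrakk> \<Longrightarrow> x \<in> I (N - d)"
begin

text \<open>Extending the filtration by \<open>A\<close> in negative degrees removes all case distinctions between
  entries below and above the diagonal, and multiplicativity persists.\<close>

definition J :: "int \<Rightarrow> 'a set" where
  "J d = (if d > 0 then I (nat d) else carrier A)"

abbreviation L :: "int \<Rightarrow> int \<Rightarrow> 'a set" where
  "L r c \<equiv> J (int N + r - c)"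

lemma entry_modulus_eq: "entry_modulus A N I = L"
proof (intro ext)
  fix r c
  have 1: "I N = {\<zero>\<^bsub>A\<^esub>}" "I (nat (int N + r - c)) = {\<zero>\<^bsub>A\<^esub>}" if "r > c"
    using filtration that by (auto simp: ideal_filtration_def)
  have 2: "nat (int N + r - c) = N - nat (c - r)" if "r \<le> c" using that by simp
  show "entry_modulus A N I r c = L r c"
    using 1 2 by (auto simp: entry_modulus_def J_def)
qed

lemma entry_space_eq: "entry_space A N I r c = (\<lambda>x. L r c +>\<^bsub>A\<^esub> x) ` J (r - c)"
  by (simp add: entry_space_def entry_modulus_eq J_def)

lemma J_ideal: "ideal (J d) A"
  using filtration A.oneideal by (simp add: J_def ideal_filtration_def)

lemma J_carrier: "x \<in> J d \<Longrightarrow> x \<in> carrier A"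
  using ideal.Icarr[OF J_ideal] .

lemma J_zero: "\<zero>\<^bsub>A\<^esub> \<in> J d"
  using J_ideal by (simp add: additive_subgroup.zero_closed ideal.axioms(1))

lemma I_antimono: "i \<le> j \<Longrightarrow> I j \<subseteq> I i"
proof (rule lift_Suc_antimono_le)
  fix n show "I (Suc n) \<subseteq> I n"
    using filtration by (cases "n < N") (auto simp: ideal_filtration_def)
qed

lemma J_antimono: "i \<le> j \<Longrightarrow> J j \<subseteq> J i"
  using I_antimono[of "nat i" "nat j"] J_carrier[of _ j] by (auto simp: J_def)

lemma J_mult: assumes "x \<in> J i" "y \<in> J j" shows "x \<otimes>\<^bsub>A\<^esub> y \<in> J (i + j)"
proof -
  consider "i > 0" "j > 0" | "i \<le> 0" | "j \<le> 0" by linarith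
  then show ?thesis
  proof cases
    case 1
    then have "x \<otimes>\<^bsub>A\<^esub> y \<in> I (nat i + nat j)"
      using assms by (intro ideal_filtration_mult[OF filtration]) (auto simp: J_def)
    then show ?thesis using 1 by (simp add: J_def nat_add_distrib)
  next
    case 2
    then have "x \<otimes>\<^bsub>A\<^esub> y \<in> J j"
      using assms J_carrier ideal.I_l_closed[OF J_ideal] by blast
    then show ?thesis using J_antimono[of "i + j" j] 2 by auto
  next
    case 3
    then have "x \<otimes>\<^bsub>A\<^esub> y \<in> J i"
      using assms J_carrier ideal.I_r_closed[OF J_ideal] by blast
    then show ?thesis using J_antimono[of "i + j" i] 3 by auto
  qed
qed

lemma J_large: "d \<ge> int N \<Longrightarrow> J d = {\<zero>\<^bsub>A\<^esub>}"
  using filtration by (auto simp: J_def ideal_filtration_def)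

lemma J_add: "\<lbrakk>x \<in> J d; y \<in> J d\<rbrakk> \<Longrightarrow> x \<oplus>\<^bsub>A\<^esub> y \<in> J d"
  using J_ideal by (simp add: additive_subgroup.a_closed ideal.axioms(1))

lemma J_smult: assumes "k \<in> carrier K" "x \<in> J d" shows "k \<odot>\<^bsub>A\<^esub> x \<in> J d"
proof -
  have "(k \<odot>\<^bsub>A\<^esub> \<one>\<^bsub>A\<^esub>) \<otimes>\<^bsub>A\<^esub> x \<in> J d"
    using assms smult_closed by (intro ideal.I_l_closed[OF J_ideal]) auto
  then show ?thesis using assms J_carrier by (simp add: smult_mult_left)
qed

lemma form_closed [simp]: "\<lbrakk>x \<in> carrier A; y \<in> carrier A\<rbrakk> \<Longrightarrow> B x y \<in> carrier K"
  and form_add_left: "\<lbrakk>x \<in> carrier A; y \<in> carrier A; z \<in> carrier A\<rbrakk>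
    \<Longrightarrow> B (x \<oplus>\<^bsub>A\<^esub> y) z = B x z \<oplus>\<^bsub>K\<^esub> B y z"
  and form_smult_left: "\<lbrakk>k \<in> carrier K; x \<in> carrier A; y \<in> carrier A\<rbrakk>
    \<Longrightarrow> B (k \<odot>\<^bsub>A\<^esub> x) y = k \<otimes>\<^bsub>K\<^esub> B x y"
  using form by (auto simp: bilinear_form_def)

lemma form_add_right: "\<lbrakk>x \<in> carrier A; y \<in> carrier A; z \<in> carrier A\<rbrakk>
    \<Longrightarrow> B x (y \<oplus>\<^bsub>A\<^esub> z) = B x y \<oplus>\<^bsub>K\<^esub> B x z"
  using form by (auto simp: bilinear_form_def)

lemma form_zero_left [simp]: assumes "x \<in> carrier A" shows "B \<zero>\<^bsub>A\<^esub> x = \<zero>\<^bsub>K\<^esub>"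
proof -
  have "B \<zero>\<^bsub>A\<^esub> x \<oplus>\<^bsub>K\<^esub> B \<zero>\<^bsub>A\<^esub> x = B \<zero>\<^bsub>A\<^esub> x"
    using form_add_left[of "\<zero>\<^bsub>A\<^esub>" "\<zero>\<^bsub>A\<^esub>" x] assms by simp
  then show ?thesis using assms K.add.l_cancel_one' form_closed[OF A.zero_closed assms] by metis
qed

lemma form_zero_right [simp]: "x \<in> carrier A \<Longrightarrow> B x \<zero>\<^bsub>A\<^esub> = \<zero>\<^bsub>K\<^esub>"
  using form_sym form_zero_left by simp

lemma form_finsum_left:
  assumes "finite S" "f \<in> S \<rightarrow> carrier A" "y \<in> carrier A"
  shows "B (\<Oplus>\<^bsub>A\<^esub>s\<in>S. f s) y = (\<Oplus>\<^bsub>K\<^esub>s\<in>S. B (f s) y)"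
  using assms
proof (induction S rule: finite_induct)
  case (insert u S)
  then have "(\<lambda>s. B (f s) y) \<in> S \<rightarrow> carrier K" by (auto intro!: form_closed)
  then show ?case using insert by (simp add: form_add_left)
qed simp

lemma form_finsum_right:
  assumes "finite S" "f \<in> S \<rightarrow> carrier A" "y \<in> carrier A"
  shows "B y (\<Oplus>\<^bsub>A\<^esub>s\<in>S. f s) = (\<Oplus>\<^bsub>K\<^esub>s\<in>S. B y (f s))"
proof -
  have "B y (\<Oplus>\<^bsub>A\<^esub>s\<in>S. f s) = (\<Oplus>\<^bsub>K\<^esub>s\<in>S. B (f s) y)"
    using assms form_sym[of y "\<Oplus>\<^bsub>A\<^esub>s\<in>S. f s"] form_finsum_left by simp
  also have "\<dots> = (\<Oplus>\<^bsub>K\<^esub>s\<in>S. B y (f s))"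
    using assms form_sym by (intro K.finsum_cong') (auto simp: Pi_def)
  finally show ?thesis .
qed

text \<open>The product \<open>x \<otimes>\<^bsub>A\<^esub> y\<close> lies in degree at least \<open>N\<close>, hence vanishes, and \<open>B x y = B (x \<otimes>\<^bsub>A\<^esub> y) \<one>\<^bsub>A\<^esub>\<close>.\<close>

lemma orthogonal: assumes "x \<in> J i" "y \<in> J j" "i + j \<ge> int N" shows "B x y = \<zero>\<^bsub>K\<^esub>"
proof -
  have xy: "x \<in> carrier A" "y \<in> carrier A" using assms J_carrier by auto
  have "x \<otimes>\<^bsub>A\<^esub> y = \<zero>\<^bsub>A\<^esub>" using J_mult[OF assms(1,2)] J_large[OF assms(3)] by simp
  then show ?thesis using form_assoc[of x y "\<one>\<^bsub>A\<^esub>"] xy by simp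
qed

text \<open>The self-duality in all integer degrees. For \<open>d \<le> 0\<close> it is non-degeneracy (take \<open>d = 0\<close> in the
  locale assumption), for \<open>d > N\<close> it holds because \<open>J (N - d) = A\<close>.\<close>

lemma orthogonal_imp_mem:
  assumes x: "x \<in> carrier A" and orth: "\<And>y. y \<in> J d \<Longrightarrow> B x y = \<zero>\<^bsub>K\<^esub>"
  shows "x \<in> J (int N - d)"
proof -
  consider "d \<le> 0" | "0 < d" "d \<le> int N" | "d > int N" by linarith
  then show ?thesis
  proof cases
    case 1
    then have "x \<in> I (N - 0)"
      using x orth filtration by (intro orthogonal_subset) (auto simp: J_def ideal_filtration_def)
    then show ?thesis using filtration J_zero by (auto simp: ideal_filtration_def)
  next
    case 2
    then have "x \<in> I (N - nat d)"
      using x orth by (intro orthogonal_subset) (auto simp: J_def)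
    then show ?thesis using 2 x by (simp add: J_def nat_diff_distrib)
  next
    case 3
    then show ?thesis using x by (simp add: J_def)
  qed
qed

section \<open>Matrices of representatives\<close>

text \<open>Elements of the matrix algebra are handled through matrices of representatives in \<open>A\<close>.\<close>

definition coset_matrix :: "(int \<Rightarrow> int \<Rightarrow> 'a) \<Rightarrow> int \<Rightarrow> int \<Rightarrow> 'a set" where
  "coset_matrix f = (\<lambda>r c. L r c +>\<^bsub>A\<^esub> f r c)"

text \<open>Confining the nonzero entries to a finite square \<open>S \<times> S\<close>, which can be shared by several
  matrices, lets every sum that occurs range over the same index set \<open>S\<close>.\<close>

definition block_matrix :: "int set \<Rightarrow> (int \<Rightarrow> int \<Rightarrow> 'a) \<Rightarrow> bool" where
  "block_matrix S f \<longleftrightarrow> finite S \<and> (\<forall>r c. f r c \<in> J (r - c)) \<and>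
     (\<forall>r c. r \<in> S \<and> c \<in> S \<or> f r c = \<zero>\<^bsub>A\<^esub>)"

abbreviation C :: "('k, int \<Rightarrow> int \<Rightarrow> 'a set) module" where
  "C \<equiv> matrix_algebra_C A N I"

lemma block_matrix_carrier: "block_matrix S f \<Longrightarrow> f r c \<in> carrier A"
  using J_carrier by (auto simp: block_matrix_def)

lemma block_matrix_mono: "\<lbrakk>block_matrix S f; S \<subseteq> T; finite T\<rbrakk> \<Longrightarrow> block_matrix T f"
  by (fastforce simp: block_matrix_def)

lemma coset_eq_modulus_iff: assumes "x \<in> carrier A" shows "J d +>\<^bsub>A\<^esub> x = J d \<longleftrightarrow> x \<in> J d"
proof -
  interpret ideal "J d" A by (rule J_ideal)
  show ?thesis
    using assms A.a_coset_join1[OF _ assms a_subgroup] A.a_coset_join2[OF assms a_subgroup] by blast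
qed

lemma coset_eqI: assumes "x \<in> carrier A" "y \<in> J d +>\<^bsub>A\<^esub> x" shows "J d +>\<^bsub>A\<^esub> y = J d +>\<^bsub>A\<^esub> x"
proof -
  interpret ideal "J d" A by (rule J_ideal)
  show ?thesis using A.a_repr_independence[OF assms(2,1) a_subgroup] by simp
qed

lemma coset_memI: "l \<in> J d \<Longrightarrow> l \<oplus>\<^bsub>A\<^esub> x \<in> J d +>\<^bsub>A\<^esub> x"
  by (auto simp: a_r_coset_def')

lemma coset_memE:
  assumes "y \<in> J d +>\<^bsub>A\<^esub> x" obtains l where "l \<in> J d" "y = l \<oplus>\<^bsub>A\<^esub> x"
  using assms by (auto simp: a_r_coset_def')

lemma modulus_subset: "L r c \<subseteq> J (r - c)"
  by (rule J_antimono) simp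

lemma mem_self_coset: "x \<in> carrier A \<Longrightarrow> x \<in> J d +>\<^bsub>A\<^esub> x"
  using coset_memI[OF J_zero, of x] by simp

lemma coset_matrix_outside:
  assumes "block_matrix S f" "r \<notin> S \<or> c \<notin> S" shows "coset_matrix f r c = L r c"
proof -
  have "f r c = \<zero>\<^bsub>A\<^esub>" using assms by (auto simp: block_matrix_def)
  then show ?thesis using coset_eq_modulus_iff[OF A.zero_closed] J_zero by (simp add: coset_matrix_def)
qed

lemma coset_matrix_carrier:
  assumes f: "block_matrix S f" shows "coset_matrix f \<in> carrier C"
proof -
  have "{(r, c). coset_matrix f r c \<noteq> L r c} \<subseteq> S \<times> S"
    using coset_matrix_outside[OF f] by blast
  then have "finite {(r, c). coset_matrix f r c \<noteq> L r c}"
    using f finite_subset[OF _ finite_cartesian_product[of S S]] by (simp add: block_matrix_def)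
  moreover have "coset_matrix f r c \<in> entry_space A N I r c" for r c
    using f unfolding entry_space_eq coset_matrix_def block_matrix_def by blast
  ultimately show ?thesis
    by (simp add: matrix_algebra_C_def entry_modulus_eq)
qed

text \<open>The representative of a zero entry has to be chosen as \<open>\<zero>\<close>, or else the support could become infinite.\<close>

lemma carrier_C_representative:
  assumes F: "F \<in> carrier C"
  obtains S f where "block_matrix S f" "F = coset_matrix f"
proof -
  have entries: "F r c \<in> (\<lambda>x. L r c +>\<^bsub>A\<^esub> x) ` J (r - c)" for r c
    using F by (simp add: matrix_algebra_C_def entry_modulus_eq entry_space_eq)
  have fin: "finite {(r, c). F r c \<noteq> L r c}"
    using F by (simp add: matrix_algebra_C_def entry_modulus_eq)
  have "\<exists>x. x \<in> J (r - c) \<and> F r c = L r c +>\<^bsub>A\<^esub> x \<and> (F r c = L r c \<longrightarrow> x = \<zero>\<^bsub>A\<^esub>)" for r c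
    using entries[of r c] coset_eq_modulus_iff[OF A.zero_closed] J_zero by blast
  then obtain f where f: "\<And>r c. f r c \<in> J (r - c)" "\<And>r c. F r c = L r c +>\<^bsub>A\<^esub> f r c"
    "\<And>r c. F r c = L r c \<Longrightarrow> f r c = \<zero>\<^bsub>A\<^esub>"
    by metis
  let ?D = "{(r, c). F r c \<noteq> L r c}"
  have "block_matrix (fst ` ?D \<union> snd ` ?D) f"
    unfolding block_matrix_def
  proof (intro conjI allI)
    fix r c
    show "r \<in> fst ` ?D \<union> snd ` ?D \<and> c \<in> fst ` ?D \<union> snd ` ?D \<or> f r c = \<zero>\<^bsub>A\<^esub>"
    proof (cases "F r c = L r c")
      case False
      then have "(r, c) \<in> ?D" by simp
      then show ?thesis by (intro disjI1 conjI UnI1[OF rev_image_eqI] UnI2[OF rev_image_eqI]) auto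
    qed (simp add: f(3))
  qed (use fin f(1) in simp_all)
  moreover have "F = coset_matrix f"
    using f(2) by (simp add: coset_matrix_def fun_eq_iff)
  ultimately show ?thesis by (rule that)
qed

lemma carrier_C_representatives2:
  assumes "F \<in> carrier C" "G \<in> carrier C"
  obtains S f g where "block_matrix S f" "F = coset_matrix f" "block_matrix S g" "G = coset_matrix g"
proof -
  obtain S f where f: "block_matrix S f" "F = coset_matrix f"
    using assms(1) by (rule carrier_C_representative)
  obtain T g where g: "block_matrix T g" "G = coset_matrix g"
    using assms(2) by (rule carrier_C_representative)
  have fin: "finite (S \<union> T)" using f g by (simp add: block_matrix_def)
  show ?thesis
    using that[OF block_matrix_mono[OF f(1) _ fin] f(2) block_matrix_mono[OF g(1) _ fin] g(2)]
    by simp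
qed

lemma carrier_C_representatives3:
  assumes "F \<in> carrier C" "G \<in> carrier C" "H \<in> carrier C"
  obtains S f g h where "block_matrix S f" "F = coset_matrix f" "block_matrix S g" "G = coset_matrix g"
    "block_matrix S h" "H = coset_matrix h"
proof -
  obtain S f g where fg: "block_matrix S f" "F = coset_matrix f" "block_matrix S g" "G = coset_matrix g"
    using assms(1,2) by (rule carrier_C_representatives2)
  obtain T h where h: "block_matrix T h" "H = coset_matrix h"
    using assms(3) by (rule carrier_C_representative)
  have fin: "finite (S \<union> T)" using fg h by (simp add: block_matrix_def)
  show ?thesis
    using that[OF block_matrix_mono[OF fg(1) _ fin] fg(2) block_matrix_mono[OF fg(3) _ fin] fg(4)
        block_matrix_mono[OF h(1) _ fin] h(2)]
    by simp
qed

lemma block_matrix_add: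
  "\<lbrakk>block_matrix S f; block_matrix S g\<rbrakk> \<Longrightarrow> block_matrix S (\<lambda>r c. f r c \<oplus>\<^bsub>A\<^esub> g r c)"
  unfolding block_matrix_def by (metis J_add A.r_zero A.zero_closed)

lemma coset_matrix_add:
  assumes "block_matrix S f" "block_matrix S g"
  shows "coset_matrix f \<oplus>\<^bsub>C\<^esub> coset_matrix g = coset_matrix (\<lambda>r c. f r c \<oplus>\<^bsub>A\<^esub> g r c)"
  using ideal.a_rcos_sum[OF J_ideal block_matrix_carrier[OF assms(1)] block_matrix_carrier[OF assms(2)]]
  by (simp add: matrix_algebra_C_def coset_matrix_def Let_def)

lemma block_matrix_smult:
  assumes "k \<in> carrier K" "block_matrix S f" shows "block_matrix S (\<lambda>r c. k \<odot>\<^bsub>A\<^esub> f r c)"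
proof -
  have "k \<odot>\<^bsub>A\<^esub> \<zero>\<^bsub>A\<^esub> = \<zero>\<^bsub>A\<^esub>"
    using J_smult[OF assms(1), of "\<zero>\<^bsub>A\<^esub>" "int N"] J_large by simp
  then show ?thesis using assms unfolding block_matrix_def by (metis J_smult)
qed

lemma coset_matrix_smult:
  assumes k: "k \<in> carrier K" and f: "block_matrix S f"
  shows "k \<odot>\<^bsub>C\<^esub> coset_matrix f = coset_matrix (\<lambda>r c. k \<odot>\<^bsub>A\<^esub> f r c)"
proof -
  have "coset_smult A (L r c) k (L r c +>\<^bsub>A\<^esub> f r c) = L r c +>\<^bsub>A\<^esub> (k \<odot>\<^bsub>A\<^esub> f r c)" for r c
    unfolding coset_smult_def
  proof (rule ideal.UN_coset_eqI[OF J_ideal])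
    fix y assume "y \<in> L r c +>\<^bsub>A\<^esub> f r c"
    then obtain l where l: "l \<in> L r c" "y = l \<oplus>\<^bsub>A\<^esub> f r c" by (rule coset_memE)
    then have "k \<odot>\<^bsub>A\<^esub> y = k \<odot>\<^bsub>A\<^esub> l \<oplus>\<^bsub>A\<^esub> k \<odot>\<^bsub>A\<^esub> f r c"
      using k block_matrix_carrier[OF f] J_carrier by (simp add: smult_r_distr)
    then show "k \<odot>\<^bsub>A\<^esub> y \<in> L r c +>\<^bsub>A\<^esub> (k \<odot>\<^bsub>A\<^esub> f r c)"
      using coset_memI[OF J_smult[OF k l(1)]] by simp
  qed (use k block_matrix_carrier[OF f] smult_closed mem_self_coset in auto)
  then show ?thesis
    by (simp add: matrix_algebra_C_def coset_matrix_def entry_modulus_eq)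
qed

text \<open>Well-definedness of the product: changing \<open>x\<close> by \<open>J\<^bsub>N+r-s\<^esub>\<close> or \<open>y\<close> by \<open>J\<^bsub>N+s-t\<^esub>\<close> changes \<open>x \<otimes>\<^bsub>A\<^esub> y\<close> by an element of \<open>J\<^bsub>N+r-t\<^esub>\<close>,
  by multiplicativity.\<close>

lemma entry_mult:
  assumes x: "x \<in> J (r - s)" and y: "y \<in> J (s - t)"
  shows "rcoset_mult A (L r t) (L r s +>\<^bsub>A\<^esub> x) (L s t +>\<^bsub>A\<^esub> y) = L r t +>\<^bsub>A\<^esub> (x \<otimes>\<^bsub>A\<^esub> y)"
proof -
  have carr: "x \<in> carrier A" "y \<in> carrier A" using x y J_carrier by auto
  have same: "L r t +>\<^bsub>A\<^esub> (x' \<otimes>\<^bsub>A\<^esub> y') = L r t +>\<^bsub>A\<^esub> (x \<otimes>\<^bsub>A\<^esub> y)"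
    if x': "x' \<in> L r s +>\<^bsub>A\<^esub> x" and y': "y' \<in> L s t +>\<^bsub>A\<^esub> y" for x' y'
  proof (rule coset_eqI)
    obtain l where l: "l \<in> L r s" "x' = l \<oplus>\<^bsub>A\<^esub> x" using x' by (rule coset_memE)
    obtain m where m: "m \<in> L s t" "y' = m \<oplus>\<^bsub>A\<^esub> y" using y' by (rule coset_memE)
    have J_y': "y' \<in> J (s - t)"
      unfolding m(2) using subsetD[OF modulus_subset m(1)] y by (rule J_add)
    have "l \<otimes>\<^bsub>A\<^esub> y' \<in> L r t" "x \<otimes>\<^bsub>A\<^esub> m \<in> L r t"
      using J_mult[OF l(1) J_y'] J_mult[OF x m(1)] by (simp_all add: algebra_simps)
    then have mem: "l \<otimes>\<^bsub>A\<^esub> y' \<oplus>\<^bsub>A\<^esub> x \<otimes>\<^bsub>A\<^esub> m \<in> L r t" by (rule J_add)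
    moreover have "x' \<otimes>\<^bsub>A\<^esub> y' = l \<otimes>\<^bsub>A\<^esub> y' \<oplus>\<^bsub>A\<^esub> x \<otimes>\<^bsub>A\<^esub> y'"
      unfolding l(2) using carr J_carrier[OF l(1)] J_carrier[OF J_y'] by (simp add: A.l_distr)
    moreover have "x \<otimes>\<^bsub>A\<^esub> y' = x \<otimes>\<^bsub>A\<^esub> m \<oplus>\<^bsub>A\<^esub> x \<otimes>\<^bsub>A\<^esub> y"
      unfolding m(2) using carr J_carrier[OF m(1)] by (simp add: A.r_distr)
    ultimately have "x' \<otimes>\<^bsub>A\<^esub> y' = (l \<otimes>\<^bsub>A\<^esub> y' \<oplus>\<^bsub>A\<^esub> x \<otimes>\<^bsub>A\<^esub> m) \<oplus>\<^bsub>A\<^esub> x \<otimes>\<^bsub>A\<^esub> y"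
      using carr J_carrier[OF l(1)] J_carrier[OF m(1)] J_carrier[OF J_y'] by (simp add: A.a_assoc)
    then show "x' \<otimes>\<^bsub>A\<^esub> y' \<in> L r t +>\<^bsub>A\<^esub> (x \<otimes>\<^bsub>A\<^esub> y)"
      using coset_memI[OF mem] by simp
  qed (use carr in simp)
  have "x \<in> L r s +>\<^bsub>A\<^esub> x" "y \<in> L s t +>\<^bsub>A\<^esub> y" using mem_self_coset carr by blast+
  then show ?thesis
    unfolding rcoset_mult_def by (intro equalityI UN_least eq_refl[OF same]) (assumption | blast)+
qed

lemma block_matrix_mult:
  assumes f: "block_matrix S f" and g: "block_matrix S g"
  shows "block_matrix S (\<lambda>r t. \<Oplus>\<^bsub>A\<^esub>s\<in>S. f r s \<otimes>\<^bsub>A\<^esub> g s t)"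
proof -
  have fin: "finite S" using f by (simp add: block_matrix_def)
  have "(\<Oplus>\<^bsub>A\<^esub>s\<in>T. f r s \<otimes>\<^bsub>A\<^esub> g s t) \<in> J (r - t)" if "finite T" for r t T
    using that
  proof (induction T rule: finite_induct)
    case (insert s T)
    have "f r s \<otimes>\<^bsub>A\<^esub> g s t \<in> J (r - t)"
      using J_mult[of "f r s" "r - s" "g s t" "s - t"] f g by (simp add: block_matrix_def)
    then show ?case
      using insert J_add block_matrix_carrier[OF f] block_matrix_carrier[OF g] by simp
  qed (simp add: J_zero)
  moreover have "(\<Oplus>\<^bsub>A\<^esub>s\<in>S. f r s \<otimes>\<^bsub>A\<^esub> g s t) = \<zero>\<^bsub>A\<^esub>" if "r \<notin> S \<or> t \<notin> S" for r t
  proof -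
    have "f r s = \<zero>\<^bsub>A\<^esub> \<or> g s t = \<zero>\<^bsub>A\<^esub>" for s
      using that f g by (auto simp: block_matrix_def)
    then have "f r s \<otimes>\<^bsub>A\<^esub> g s t = \<zero>\<^bsub>A\<^esub>" for s
      using block_matrix_carrier[OF f] block_matrix_carrier[OF g] by (metis A.l_null A.r_null)
    then show ?thesis by simp
  qed
  ultimately show ?thesis unfolding block_matrix_def using fin by metis
qed

text \<open>The product of matrices sums over those \<open>s\<close> with a nonzero coset at \<open>(r, s)\<close> on the left. For
  all other \<open>s \<in> S\<close> the product of representatives need not vanish in \<open>A\<close>, but it lies in \<open>L r t\<close>;
  so the index set is enlarged to \<open>S\<close> while still computing in the quotient.\<close>

lemma coset_matrix_mult:
  assumes f: "block_matrix S f" and g: "block_matrix S g"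
  shows "coset_matrix f \<otimes>\<^bsub>C\<^esub> coset_matrix g = coset_matrix (\<lambda>r t. \<Oplus>\<^bsub>A\<^esub>s\<in>S. f r s \<otimes>\<^bsub>A\<^esub> g s t)"
proof (intro ext)
  fix r t
  interpret ideal "L r t" A by (rule J_ideal)
  interpret Q: ring "A Quot L r t" by (rule quotient_is_ring)
  note carr = block_matrix_carrier[OF f] block_matrix_carrier[OF g]
  let ?T = "{s. coset_matrix f r s \<noteq> L r s}"
  have fin: "finite S" and J: "f r c \<in> J (r - c)" "g r c \<in> J (r - c)" for r c
    using f g by (auto simp: block_matrix_def)
  have eq: "rcoset_mult A (L r t) (coset_matrix f r s) (coset_matrix g s t)
      = L r t +>\<^bsub>A\<^esub> (f r s \<otimes>\<^bsub>A\<^esub> g s t)" for s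
    using entry_mult J by (simp add: coset_matrix_def)
  have "(coset_matrix f \<otimes>\<^bsub>C\<^esub> coset_matrix g) r t
      = (\<Oplus>\<^bsub>A Quot L r t\<^esub>s\<in>?T. L r t +>\<^bsub>A\<^esub> (f r s \<otimes>\<^bsub>A\<^esub> g s t))"
    by (simp add: matrix_algebra_C_def entry_modulus_eq eq)
  also have "\<dots> = (\<Oplus>\<^bsub>A Quot L r t\<^esub>s\<in>S. L r t +>\<^bsub>A\<^esub> (f r s \<otimes>\<^bsub>A\<^esub> g s t))"
  proof (rule Q.add.finprod_mono_neutral_cong_left[OF fin])
    show "?T \<subseteq> S"
      using coset_matrix_outside[OF f] by blast
    fix s assume "s \<in> S - ?T"
    then have "f r s \<in> L r s"
      using coset_eq_modulus_iff carr by (simp add: coset_matrix_def)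
    then have "f r s \<otimes>\<^bsub>A\<^esub> g s t \<in> J (int N + r - s + (s - t))"
      using J(2) by (rule J_mult)
    moreover have "int N + r - s + (s - t) = int N + r - t" by linarith
    ultimately have "f r s \<otimes>\<^bsub>A\<^esub> g s t \<in> L r t" by (simp only:)
    then show "L r t +>\<^bsub>A\<^esub> (f r s \<otimes>\<^bsub>A\<^esub> g s t) = \<zero>\<^bsub>A Quot L r t\<^esub>"
      using coset_eq_modulus_iff carr by (simp add: FactRing_def)
  next
    have "L r t +>\<^bsub>A\<^esub> (f r s \<otimes>\<^bsub>A\<^esub> g s t) \<in> carrier (A Quot L r t)" for s
      using A.a_rcosetsI[OF a_subset A.m_closed[OF carr]] by (simp add: FactRing_def)
    then show "(\<lambda>s. L r t +>\<^bsub>A\<^esub> (f r s \<otimes>\<^bsub>A\<^esub> g s t)) \<in> S \<rightarrow> carrier (A Quot L r t)" by simp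
  qed (rule refl)
  also have "\<dots> = L r t +>\<^bsub>A\<^esub> (\<Oplus>\<^bsub>A\<^esub>s\<in>S. f r s \<otimes>\<^bsub>A\<^esub> g s t)"
    using carr by (intro finsum_quotient[OF fin]) auto
  finally show "(coset_matrix f \<otimes>\<^bsub>C\<^esub> coset_matrix g) r t
      = coset_matrix (\<lambda>r t. \<Oplus>\<^bsub>A\<^esub>s\<in>S. f r s \<otimes>\<^bsub>A\<^esub> g s t) r t"
    by (simp add: coset_matrix_def)
qed

section \<open>The trace form\<close>

text \<open>Meaningful only if \<open>B\<close> is constant on \<open>U \<times> V\<close>, as it is for entries in transposed positions
  (\<open>entry_pairing_eq\<close>).\<close>

definition entry_pairing :: "'a set \<Rightarrow> 'a set \<Rightarrow> 'k" where
  "entry_pairing U V = the_elem ((\<lambda>(x, y). B x y) ` (U \<times> V))"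

text \<open>The index set is a square around the support of \<open>F\<close>: outside it the entries of \<open>F\<close> are zero
  and contribute nothing to the trace of the product.\<close>

definition matrix_form :: "(int \<Rightarrow> int \<Rightarrow> 'a set) \<Rightarrow> (int \<Rightarrow> int \<Rightarrow> 'a set) \<Rightarrow> 'k" where
  "matrix_form F G = (let S = {i. \<exists>j. F i j \<noteq> L i j \<or> F j i \<noteq> L j i} in
     \<Oplus>\<^bsub>K\<^esub>r\<in>S. \<Oplus>\<^bsub>K\<^esub>c\<in>S. entry_pairing (F r c) (G c r))"

text \<open>Well-definedness: \<open>L r c\<close> has degree \<open>N + r - c\<close>, and so is orthogonal to \<open>J (c - r)\<close>.\<close>

lemma entry_pairing_eq:
  assumes x: "x \<in> J (r - c)" and y: "y \<in> J (c - r)"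
  shows "entry_pairing (L r c +>\<^bsub>A\<^esub> x) (L c r +>\<^bsub>A\<^esub> y) = B x y"
proof -
  have carr: "x \<in> carrier A" "y \<in> carrier A" using x y J_carrier by auto
  have value_eq: "B x' y' = B x y" if x': "x' \<in> L r c +>\<^bsub>A\<^esub> x" and y': "y' \<in> L c r +>\<^bsub>A\<^esub> y" for x' y'
  proof -
    obtain l where l: "l \<in> L r c" "x' = l \<oplus>\<^bsub>A\<^esub> x" using x' by (rule coset_memE)
    obtain m where m: "m \<in> L c r" "y' = m \<oplus>\<^bsub>A\<^esub> y" using y' by (rule coset_memE)
    have J_y': "y' \<in> J (c - r)"
      unfolding m(2) using subsetD[OF modulus_subset m(1)] y by (rule J_add)
    have "B l y' = \<zero>\<^bsub>K\<^esub>" "B x m = \<zero>\<^bsub>K\<^esub>"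
      using orthogonal[OF l(1) J_y'] orthogonal[OF x m(1)] by simp_all
    moreover have "B x' y' = B l y' \<oplus>\<^bsub>K\<^esub> B x y'"
      unfolding l(2) using carr J_carrier[OF l(1)] J_carrier[OF J_y'] by (simp add: form_add_left)
    moreover have "B x y' = B x m \<oplus>\<^bsub>K\<^esub> B x y"
      unfolding m(2) using carr J_carrier[OF m(1)] by (simp add: form_add_right)
    ultimately show ?thesis using carr by simp
  qed
  let ?P = "(L r c +>\<^bsub>A\<^esub> x) \<times> (L c r +>\<^bsub>A\<^esub> y)"
  have "(x, y) \<in> ?P" using mem_self_coset carr by simp
  moreover have "(case p of (x', y') \<Rightarrow> B x' y') = B x y" if "p \<in> ?P" for p
    using value_eq[of "fst p" "snd p"] that by (simp add: mem_Times_iff split_beta)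
  ultimately have "the_elem ((\<lambda>(x', y'). B x' y') ` ?P) = B x y"
    by (intro the_elem_image_unique) blast+
  then show ?thesis by (simp add: entry_pairing_def)
qed

lemma matrix_form_eq:
  assumes f: "block_matrix S f" and g: "block_matrix S g"
  shows "matrix_form (coset_matrix f) (coset_matrix g) = (\<Oplus>\<^bsub>K\<^esub>r\<in>S. \<Oplus>\<^bsub>K\<^esub>c\<in>S. B (f r c) (g c r))"
proof -
  let ?F = "coset_matrix f"
  let ?T = "{i. \<exists>j. ?F i j \<noteq> L i j \<or> ?F j i \<noteq> L j i}"
  note carr = block_matrix_carrier[OF f] block_matrix_carrier[OF g]
  have fin: "finite S" and J: "f r c \<in> J (r - c)" "g r c \<in> J (r - c)" for r c
    using f g by (auto simp: block_matrix_def)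
  have T: "?T \<subseteq> S" using coset_matrix_outside[OF f] by blast
  have zero: "B (f r c) (g c r) = \<zero>\<^bsub>K\<^esub>" if "r \<notin> ?T \<or> c \<notin> ?T" for r c
  proof -
    have "?F r c = L r c" using that by blast
    then have "f r c \<in> L r c" using coset_eq_modulus_iff[OF carr(1)] by (simp add: coset_matrix_def)
    then show ?thesis using orthogonal[OF _ J(2)[of c r]] by simp
  qed
  have "matrix_form ?F (coset_matrix g) = (\<Oplus>\<^bsub>K\<^esub>r\<in>?T. \<Oplus>\<^bsub>K\<^esub>c\<in>?T. B (f r c) (g c r))"
    using entry_pairing_eq[OF J] by (simp add: matrix_form_def coset_matrix_def Let_def)
  also have "\<dots> = (\<Oplus>\<^bsub>K\<^esub>r\<in>?T. \<Oplus>\<^bsub>K\<^esub>c\<in>S. B (f r c) (g c r))"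
    using carr zero
    by (intro K.finsum_cong' K.add.finprod_mono_neutral_cong_left[OF fin T] K.finsum_closed) auto
  also have "\<dots> = (\<Oplus>\<^bsub>K\<^esub>r\<in>S. \<Oplus>\<^bsub>K\<^esub>c\<in>S. B (f r c) (g c r))"
    using carr zero
    by (intro K.add.finprod_mono_neutral_cong_left[OF fin T]) (auto intro!: K.finsum_closed K.add.finprod_one_eqI)
  finally show ?thesis .
qed

lemma sum_form_closed:
  assumes "block_matrix S f" "block_matrix S g"
  shows "(\<Oplus>\<^bsub>K\<^esub>r\<in>S. \<Oplus>\<^bsub>K\<^esub>c\<in>S. B (f r c) (g c r)) \<in> carrier K"
  using block_matrix_carrier[OF assms(1)] block_matrix_carrier[OF assms(2)]
  by (auto intro!: K.finsum_closed form_closed)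

lemma matrix_form_sym:
  assumes "F \<in> carrier C" "G \<in> carrier C" shows "matrix_form F G = matrix_form G F"
proof -
  obtain S f g where f: "block_matrix S f" and F: "F = coset_matrix f"
    and g: "block_matrix S g" and G: "G = coset_matrix g"
    using assms by (rule carrier_C_representatives2)
  note carr = block_matrix_carrier[OF f] block_matrix_carrier[OF g]
  have fin: "finite S" using f by (simp add: block_matrix_def)
  have "(\<Oplus>\<^bsub>K\<^esub>r\<in>S. \<Oplus>\<^bsub>K\<^esub>c\<in>S. B (f r c) (g c r)) = (\<Oplus>\<^bsub>K\<^esub>c\<in>S. \<Oplus>\<^bsub>K\<^esub>r\<in>S. B (f r c) (g c r))"
    using carr by (intro K.finsum_swap[OF fin fin]) simp
  also have "\<dots> = (\<Oplus>\<^bsub>K\<^esub>c\<in>S. \<Oplus>\<^bsub>K\<^esub>r\<in>S. B (g c r) (f r c))"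
    using carr form_sym by (intro K.finsum_cong') (auto intro!: K.finsum_closed K.finsum_cong')
  finally show ?thesis using matrix_form_eq[OF f g] matrix_form_eq[OF g f] F G by simp
qed

lemma matrix_form_add:
  assumes "F \<in> carrier C" "G \<in> carrier C" "H \<in> carrier C"
  shows "matrix_form (F \<oplus>\<^bsub>C\<^esub> G) H = matrix_form F H \<oplus>\<^bsub>K\<^esub> matrix_form G H"
proof -
  obtain S f g h where f: "block_matrix S f" and F: "F = coset_matrix f"
    and g: "block_matrix S g" and G: "G = coset_matrix g"
    and h: "block_matrix S h" and H: "H = coset_matrix h"
    using assms by (rule carrier_C_representatives3)
  note carr = block_matrix_carrier[OF f] block_matrix_carrier[OF g] block_matrix_carrier[OF h]
  have "(\<Oplus>\<^bsub>K\<^esub>r\<in>S. \<Oplus>\<^bsub>K\<^esub>c\<in>S. B (f r c \<oplus>\<^bsub>A\<^esub> g r c) (h c r))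
      = (\<Oplus>\<^bsub>K\<^esub>r\<in>S. (\<Oplus>\<^bsub>K\<^esub>c\<in>S. B (f r c) (h c r)) \<oplus>\<^bsub>K\<^esub> (\<Oplus>\<^bsub>K\<^esub>c\<in>S. B (g r c) (h c r)))"
    using carr by (simp add: form_add_left K.finsum_addf Pi_def)
  also have "\<dots> = (\<Oplus>\<^bsub>K\<^esub>r\<in>S. \<Oplus>\<^bsub>K\<^esub>c\<in>S. B (f r c) (h c r)) \<oplus>\<^bsub>K\<^esub> (\<Oplus>\<^bsub>K\<^esub>r\<in>S. \<Oplus>\<^bsub>K\<^esub>c\<in>S. B (g r c) (h c r))"
    using carr by (intro K.finsum_addf) (auto intro!: K.finsum_closed)
  finally show ?thesis
    using matrix_form_eq[OF f h] matrix_form_eq[OF g h] matrix_form_eq[OF block_matrix_add[OF f g] h]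
      coset_matrix_add[OF f g] F G H by simp
qed

lemma matrix_form_smult:
  assumes k: "k \<in> carrier K" and "F \<in> carrier C" "G \<in> carrier C"
  shows "matrix_form (k \<odot>\<^bsub>C\<^esub> F) G = k \<otimes>\<^bsub>K\<^esub> matrix_form F G"
proof -
  obtain S f g where f: "block_matrix S f" and F: "F = coset_matrix f"
    and g: "block_matrix S g" and G: "G = coset_matrix g"
    using assms(2,3) by (rule carrier_C_representatives2)
  note carr = block_matrix_carrier[OF f] block_matrix_carrier[OF g]
  have fin: "finite S" using f by (simp add: block_matrix_def)
  have "k \<otimes>\<^bsub>K\<^esub> (\<Oplus>\<^bsub>K\<^esub>r\<in>S. \<Oplus>\<^bsub>K\<^esub>c\<in>S. B (f r c) (g c r))
      = (\<Oplus>\<^bsub>K\<^esub>r\<in>S. k \<otimes>\<^bsub>K\<^esub> (\<Oplus>\<^bsub>K\<^esub>c\<in>S. B (f r c) (g c r)))"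
    using carr by (intro K.finsum_rdistr[OF fin k]) (auto intro!: K.finsum_closed)
  also have "\<dots> = (\<Oplus>\<^bsub>K\<^esub>r\<in>S. \<Oplus>\<^bsub>K\<^esub>c\<in>S. B (k \<odot>\<^bsub>A\<^esub> f r c) (g c r))"
    using carr k by (simp add: form_smult_left K.finsum_rdistr[OF fin k] Pi_def)
  finally show ?thesis
    using matrix_form_eq[OF f g] matrix_form_eq[OF block_matrix_smult[OF k f] g]
      coset_matrix_smult[OF k f] F G by simp
qed

text \<open>Both sides are the sum over \<open>r, s, t\<close> of \<open>B (f r s) (g s t \<otimes>\<^bsub>A\<^esub> h t r)\<close>; only the order of summation
  over \<open>s\<close> and \<open>t\<close> differs.\<close>

lemma matrix_form_assoc:
  assumes "F \<in> carrier C" "G \<in> carrier C" "H \<in> carrier C"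
  shows "matrix_form (F \<otimes>\<^bsub>C\<^esub> G) H = matrix_form F (G \<otimes>\<^bsub>C\<^esub> H)"
proof -
  obtain S f g h where f: "block_matrix S f" and F: "F = coset_matrix f"
    and g: "block_matrix S g" and G: "G = coset_matrix g"
    and h: "block_matrix S h" and H: "H = coset_matrix h"
    using assms by (rule carrier_C_representatives3)
  note carr = block_matrix_carrier[OF f] block_matrix_carrier[OF g] block_matrix_carrier[OF h]
  have fin: "finite S" using f by (simp add: block_matrix_def)
  have inner: "(\<Oplus>\<^bsub>K\<^esub>t\<in>S. B (\<Oplus>\<^bsub>A\<^esub>s\<in>S. f r s \<otimes>\<^bsub>A\<^esub> g s t) (h t r))
      = (\<Oplus>\<^bsub>K\<^esub>s\<in>S. B (f r s) (\<Oplus>\<^bsub>A\<^esub>t\<in>S. g s t \<otimes>\<^bsub>A\<^esub> h t r))" for r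
  proof -
    have "(\<Oplus>\<^bsub>K\<^esub>t\<in>S. B (\<Oplus>\<^bsub>A\<^esub>s\<in>S. f r s \<otimes>\<^bsub>A\<^esub> g s t) (h t r))
        = (\<Oplus>\<^bsub>K\<^esub>t\<in>S. \<Oplus>\<^bsub>K\<^esub>s\<in>S. B (f r s) (g s t \<otimes>\<^bsub>A\<^esub> h t r))"
      using carr by (simp add: form_finsum_left[OF fin] form_assoc Pi_def)
    also have "\<dots> = (\<Oplus>\<^bsub>K\<^esub>s\<in>S. \<Oplus>\<^bsub>K\<^esub>t\<in>S. B (f r s) (g s t \<otimes>\<^bsub>A\<^esub> h t r))"
      using carr by (intro K.finsum_swap[OF fin fin]) simp
    also have "\<dots> = (\<Oplus>\<^bsub>K\<^esub>s\<in>S. B (f r s) (\<Oplus>\<^bsub>A\<^esub>t\<in>S. g s t \<otimes>\<^bsub>A\<^esub> h t r))"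
      using carr by (simp add: form_finsum_right[OF fin] Pi_def)
    finally show ?thesis .
  qed
  show ?thesis
    unfolding F G H coset_matrix_mult[OF f g] coset_matrix_mult[OF g h]
      matrix_form_eq[OF block_matrix_mult[OF f g] h] matrix_form_eq[OF f block_matrix_mult[OF g h]]
      inner ..
qed

text \<open>Testing against matrices with the single nonzero entry \<open>y\<close> at \<open>(c, r)\<close> shows that \<open>f r c\<close> is
  orthogonal to \<open>J (c - r)\<close>, so that \<open>f r c\<close> lies in \<open>J (N + r - c)\<close>, which is the zero of the entry
  space.\<close>

lemma matrix_form_nondegenerate:
  assumes F: "F \<in> carrier C" and orth: "\<And>G. G \<in> carrier C \<Longrightarrow> matrix_form F G = \<zero>\<^bsub>K\<^esub>"
  shows "F = \<zero>\<^bsub>C\<^esub>"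
proof -
  obtain S f where f: "block_matrix S f" and F: "F = coset_matrix f"
    using F by (rule carrier_C_representative)
  note carr = block_matrix_carrier[OF f]
  have fin: "finite S" using f by (simp add: block_matrix_def)
  have "coset_matrix f r c = L r c" for r c
  proof (cases "r \<in> S \<and> c \<in> S")
    case True
    have "f r c \<in> J (int N - (c - r))"
    proof (rule orthogonal_imp_mem[OF carr])
      fix y assume y: "y \<in> J (c - r)"
      define g where "g = (\<lambda>i j. if i = c \<and> j = r then y else \<zero>\<^bsub>A\<^esub>)"
      have g: "block_matrix S g"
        using fin y True J_zero by (auto simp: block_matrix_def g_def)
      have "(\<Oplus>\<^bsub>K\<^esub>i\<in>S. \<Oplus>\<^bsub>K\<^esub>j\<in>S. B (f i j) (g j i))
          = (\<Oplus>\<^bsub>K\<^esub>i\<in>S. if r = i then (\<Oplus>\<^bsub>K\<^esub>j\<in>S. if c = j then B (f i j) y else \<zero>\<^bsub>K\<^esub>) else \<zero>\<^bsub>K\<^esub>)"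
        using carr J_carrier[OF y]
        by (intro K.finsum_cong') (auto simp: g_def intro!: K.finsum_closed K.finsum_cong' K.add.finprod_one_eqI)
      also have "\<dots> = (\<Oplus>\<^bsub>K\<^esub>j\<in>S. if c = j then B (f r j) y else \<zero>\<^bsub>K\<^esub>)"
        using carr J_carrier[OF y] True
        by (intro K.finsum_singleton[OF _ fin]) (auto intro!: K.finsum_closed)
      also have "\<dots> = B (f r c) y"
        using carr J_carrier[OF y] True by (intro K.finsum_singleton[OF _ fin]) auto
      finally have "matrix_form F (coset_matrix g) = B (f r c) y"
        using matrix_form_eq[OF f g] F by simp
      then show "B (f r c) y = \<zero>\<^bsub>K\<^esub>"
        using orth[OF coset_matrix_carrier[OF g]] by simp
    qed
    then show ?thesis
      using coset_eq_modulus_iff[OF carr] by (simp add: coset_matrix_def algebra_simps)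
  next
    case False
    then show ?thesis using coset_matrix_outside[OF f] by blast
  qed
  then show ?thesis
    by (simp add: F matrix_algebra_C_def entry_modulus_eq fun_eq_iff)
qed

lemma symmetric_matrix_algebra: "symmetric_algebra K C"
proof -
  have closed: "matrix_form F G \<in> carrier K" if FG: "F \<in> carrier C" "G \<in> carrier C" for F G
  proof -
    obtain S f g where f: "block_matrix S f" and F: "F = coset_matrix f"
      and g: "block_matrix S g" and G: "G = coset_matrix g"
      using FG by (rule carrier_C_representatives2)
    then show ?thesis using matrix_form_eq[OF f g] sum_form_closed[OF f g] by simp
  qed
  have add: "F \<oplus>\<^bsub>C\<^esub> G \<in> carrier C" if FG: "F \<in> carrier C" "G \<in> carrier C" for F G
  proof -
    obtain S f g where f: "block_matrix S f" and F: "F = coset_matrix f"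
      and g: "block_matrix S g" and G: "G = coset_matrix g"
      using FG by (rule carrier_C_representatives2)
    then show ?thesis
      using coset_matrix_add[OF f g] coset_matrix_carrier[OF block_matrix_add[OF f g]] by simp
  qed
  have smult: "k \<odot>\<^bsub>C\<^esub> F \<in> carrier C" if kF: "k \<in> carrier K" "F \<in> carrier C" for k F
  proof -
    obtain S f where f: "block_matrix S f" and F: "F = coset_matrix f"
      using kF(2) by (rule carrier_C_representative)
    then show ?thesis
      using coset_matrix_smult[OF kF(1) f] coset_matrix_carrier[OF block_matrix_smult[OF kF(1) f]]
      by simp
  qed
  have "matrix_form F (G \<oplus>\<^bsub>C\<^esub> H) = matrix_form F G \<oplus>\<^bsub>K\<^esub> matrix_form F H"
    if "F \<in> carrier C" "G \<in> carrier C" "H \<in> carrier C" for F G H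
    using that matrix_form_add[of G H F] matrix_form_sym[of F] add by simp
  moreover have "matrix_form F (k \<odot>\<^bsub>C\<^esub> G) = k \<otimes>\<^bsub>K\<^esub> matrix_form F G"
    if "k \<in> carrier K" "F \<in> carrier C" "G \<in> carrier C" for k F G
    using that matrix_form_smult[of k G F] matrix_form_sym[of F] smult by simp
  ultimately have bilinear: "bilinear_form K C matrix_form"
    unfolding bilinear_form_def
    by (intro conjI ballI closed matrix_form_add matrix_form_smult)
  show ?thesis
    unfolding symmetric_algebra_def
  proof (intro exI[of _ matrix_form] conjI ballI impI bilinear)
    fix F G assume "F \<in> carrier C" "G \<in> carrier C"
    then show "matrix_form F G = matrix_form G F" by (rule matrix_form_sym)
  next
    fix F G H assume "F \<in> carrier C" "G \<in> carrier C" "H \<in> carrier C"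
    then show "matrix_form (F \<otimes>\<^bsub>C\<^esub> G) H = matrix_form F (G \<otimes>\<^bsub>C\<^esub> H)" by (rule matrix_form_assoc)
  next
    fix F assume "F \<in> carrier C" "\<forall>G\<in>carrier C. matrix_form F G = \<zero>\<^bsub>K\<^esub>"
    then show "F = \<zero>\<^bsub>C\<^esub>" by (intro matrix_form_nondegenerate) simp_all
  qed
qed

end

section \<open>Symmetry of the matrix algebra\<close>

theorem corollary5:
  fixes K :: "('k, 'r) ring_scheme" and A :: "('k, 'a, 's) module_scheme"
    and N :: nat and I :: "nat \<Rightarrow> 'a set"
  assumes "algebraically_closed K"
    and "assoc_algebra K A"
    and "finite_dimensional K A"
    and "basic_algebra A"
    and "given_by_quiver_with_relations K A"
    and "ideal_filtration A N I"
    and "semisimple_subquotients A N I"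
    and "symmetric_algebra K A"
    and "\<forall>j\<le>N. I j = radical_series A (regular_module A) j"
    and "\<forall>j\<le>N. I j = socle_series A (regular_module A) (N - j)"
  shows "symmetric_algebra K (matrix_algebra_C A N I)"
proof -
  interpret alg: assoc_algebra K A by fact
  note filt = \<open>ideal_filtration A N I\<close>
  obtain B where form: "bilinear_form K A B"
    and sym: "\<And>a b. \<lbrakk>a \<in> carrier A; b \<in> carrier A\<rbrakk> \<Longrightarrow> B a b = B b a"
    and assoc: "\<And>a b c. \<lbrakk>a \<in> carrier A; b \<in> carrier A; c \<in> carrier A\<rbrakk>
      \<Longrightarrow> B (a \<otimes>\<^bsub>A\<^esub> b) c = B a (b \<otimes>\<^bsub>A\<^esub> c)"
    and nondeg: "\<And>a. \<lbrakk>a \<in> carrier A; \<And>b. b \<in> carrier A \<Longrightarrow> B a b = \<zero>\<^bsub>K\<^esub>\<rbrakk> \<Longrightarrow> a = \<zero>\<^bsub>A\<^esub>"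
    using \<open>symmetric_algebra K A\<close> unfolding symmetric_algebra_def by blast
  have top: "(regular_module A)\<lparr>carrier := I 0\<rparr> = regular_module A"
    using filt by (simp add: ideal_filtration_def regular_module_def)
  \<comment> \<open>If \<open>N = 0\<close>, there is no subquotient \<open>I\<^bsub>0\<^esub> / I\<^bsub>1\<^esub>\<close> to argue with, but then \<open>A = 0\<close>.\<close>
  have dual: "x \<in> I (N - d)"
    if "d \<le> N" "x \<in> carrier A" "\<And>y. y \<in> I d \<Longrightarrow> B x y = \<zero>\<^bsub>K\<^esub>" for d x
  proof (cases "N = 0")
    case True
    then have "carrier A = {\<zero>\<^bsub>A\<^esub>}" "I (N - d) = {\<zero>\<^bsub>A\<^esub>}"
      using filt by (auto simp: ideal_filtration_def)
    then show ?thesis using that(2) by simp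
  next
    case False
    then have "semisimple_module A (quotient_module (regular_module A) (I 1))"
      using \<open>semisimple_subquotients A N I\<close> top by (auto simp: semisimple_subquotients_def dest: spec[of _ 0])
    moreover have "y \<otimes>\<^bsub>A\<^esub> x = \<zero>\<^bsub>A\<^esub>" if "y \<in> I d" for y
      using filt assoc sym nondeg \<open>x \<in> carrier A\<close> \<open>\<And>y. y \<in> I d \<Longrightarrow> B x y = \<zero>\<^bsub>K\<^esub>\<close> that
      by (intro alg.orthogonal_imp_annihilates[where B = B and z = "\<zero>\<^bsub>K\<^esub>" and I = "I d"])
        (auto simp: ideal_filtration_def)
    ultimately show ?thesis
      using alg.annihilator_subset_socle_term[OF filt _ _ that(1,2)] assms(10) by blast
  qed
  have "self_dual_filtration K A N I B"
    by (intro self_dual_filtration.intro self_dual_filtration_axioms.intro)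
      (fact alg.R.is_cring alg.ring_axioms alg.smult_closed alg.smult_r_distr alg.smult_mult_left
        filt form sym assoc dual)+
  then show ?thesis by (rule self_dual_filtration.symmetric_matrix_algebra)
qed

end
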